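(* Let $\mu$ be an admissible even probability measure on $\mathbb{R}$ that satisfies the $\Lambda^{\ast}$-condition. Then for every $\epsilon>0$ there exists $n_0(\mu,\epsilon)\in\mathbb{N}$, depending only on $\epsilon$ and $\mu$, such that for all $r>0$ and all $n\ge n_0(\mu,\epsilon)$, $$\inf_{x\in B_r(\mu_n)}\varphi_{\mu_n}(x)\ge\exp\big(-(1+\epsilon)r-2\epsilon n\big).$$
   Context: Let $X$ have distribution $\mu$. Write $x^{\ast}=\sup\{x\in\mathbb{R}:\mu([x,\infty))>0\}$ (possibly $+\infty$), $\Lambda_\mu(t)=\ln\int e^{tx}\,d\mu(x)$, $\Lambda_\mu^{\ast}(x)=\sup_{t\in\mathbb{R}}\{tx-\Lambda_\mu(t)\}$. The measure $\mu$ is admissible if: $\mathrm{Var}(X)>0$; there is $r>0$ with $\mathbb{E}e^{tX}<\infty$ for $t\in(-r,r)$; if $x^{\ast}<\infty$ then $\mu(\{x^{\ast}\})=0$; and one of: (1) $x^{\ast}<\infty$, (2) $x^{\ast}=+\infty$ and $\{\Lambda_\mu<\infty\}=\mathbb{R}$, (3) $x^{\ast}=+\infty$, $\{\Lambda_\mu<\infty\}$ bounded and $\mu$ log-concave. It satisfies the $\Lambda^{\ast}$-condition if $\lim_{x\uparrow x^{\ast}}\frac{-\ln\mu([x,\infty))}{\Lambda_\mu^{\ast}(x)}=1$. Let $\mu_n=\mu^{\otimes n}$ on $\mathbb{R}^n$, $\Lambda_{\mu_n}(\xi)=\ln\int_{\mathbb{R}^n}e^{\langle\xi,z\rangle}d\mu_n(z)$,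 $\Lambda^{\ast}_{\mu_n}(x)=\sup_{\xi\in\mathbb{R}^n}\{\langle x,\xi\rangle-\Lambda_{\mu_n}(\xi)\}$ (which equals $\sum_{i=1}^n\Lambda_\mu^\ast(x_i)$), and $B_r(\mu_n)=\{x\in\mathbb{R}^n:\Lambda^{\ast}_{\mu_n}(x)\le r\}$. Tukey's half-space depth is $\varphi_{\mu_n}(x)=\inf\{\mu_n(H): H \text{ a half-space of } \mathbb{R}^n \text{ containing } x\}$. *)

theory Defs
  imports "HOL-Probability.Probability"
begin

definition log_mgf :: "'a measure \<Rightarrow> ('a \<Rightarrow> real) \<Rightarrow> ereal" where
  "log_mgf M f = (let I = (\<integral>\<^sup>+ z. ennreal (exp (f z)) \<partial>M) in
     if I = \<infinity> then \<infinity> else ereal (ln (enn2real I)))"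

definition Lambda1 :: "real measure \<Rightarrow> real \<Rightarrow> ereal" where
  "Lambda1 \<mu> t = log_mgf \<mu> (\<lambda>x. t * x)"

definition Lambda1_star :: "real measure \<Rightarrow> real \<Rightarrow> ereal" where
  "Lambda1_star \<mu> x = (SUP t. ereal (t * x) - Lambda1 \<mu> t)"

text \<open>The product measure \<mu>_n on R^n, with R^n rendered as extensional functions on {..<n}.\<close>
definition mu_n :: "nat \<Rightarrow> real measure \<Rightarrow> (nat \<Rightarrow> real) measure" where
  "mu_n n \<mu> = PiM {..<n} (\<lambda>_. \<mu>)"

definition inner_n :: "nat \<Rightarrow> (nat \<Rightarrow> real) \<Rightarrow> (nat \<Rightarrow> real) \<Rightarrow> real" where
  "inner_n n x y = (\<Sum>i<n. x i * y i)"

definition LambdaN :: "nat \<Rightarrow> real measure \<Rightarrow> (nat \<Rightarrow> real) \<Rightarrow> ereal" where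
  "LambdaN n \<mu> \<xi> = log_mgf (mu_n n \<mu>) (\<lambda>z. inner_n n \<xi> z)"

definition LambdaN_star :: "nat \<Rightarrow> real measure \<Rightarrow> (nat \<Rightarrow> real) \<Rightarrow> ereal" where
  "LambdaN_star n \<mu> x = (SUP \<xi>. ereal (inner_n n x \<xi>) - LambdaN n \<mu> \<xi>)"

definition B_r :: "nat \<Rightarrow> real measure \<Rightarrow> real \<Rightarrow> (nat \<Rightarrow> real) set" where
  "B_r n \<mu> r = {x \<in> {..<n} \<rightarrow>\<^sub>E UNIV. LambdaN_star n \<mu> x \<le> ereal r}"

definition halfspaces :: "nat \<Rightarrow> (nat \<Rightarrow> real) set set" where
  "halfspaces n = {{z \<in> {..<n} \<rightarrow>\<^sub>E UNIV. inner_n n \<xi> z \<ge> c} | \<xi> c. \<exists>i<n. \<xi> i \<noteq> 0}"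

definition tukey_depth :: "nat \<Rightarrow> real measure \<Rightarrow> (nat \<Rightarrow> real) \<Rightarrow> real" where
  "tukey_depth n \<mu> x = Inf {measure (mu_n n \<mu>) H | H. H \<in> halfspaces n \<and> x \<in> H}"

definition xstar :: "real measure \<Rightarrow> ereal" where
  "xstar \<mu> = Sup {ereal x | x. measure \<mu> {x..} > 0}"

definition even_measure :: "real measure \<Rightarrow> bool" where
  "even_measure \<mu> \<longleftrightarrow> (\<forall>A \<in> sets borel. measure \<mu> (uminus ` A) = measure \<mu> A)"

definition log_concave_measure :: "real measure \<Rightarrow> bool" where
  "log_concave_measure \<mu> \<longleftrightarrow>
     (\<forall>A B (l::real). A \<in> sets borel \<longrightarrow> B \<in> sets borel \<longrightarrow> 0 < l \<longrightarrow> l < 1 \<longrightarrow>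
        {l * a + (1 - l) * b | a b. a \<in> A \<and> b \<in> B} \<in> sets borel \<longrightarrow>
        measure \<mu> {l * a + (1 - l) * b | a b. a \<in> A \<and> b \<in> B}
          \<ge> measure \<mu> A powr l * measure \<mu> B powr (1 - l))"

definition admissible :: "real measure \<Rightarrow> bool" where
  "admissible \<mu> \<longleftrightarrow>
     prob_space.variance \<mu> (\<lambda>x. x) > 0 \<and>
     (\<exists>r>0. \<forall>t. - r < t \<and> t < r \<longrightarrow> integrable \<mu> (\<lambda>x. exp (t * x))) \<and>
     (xstar \<mu> < \<infinity> \<longrightarrow> measure \<mu> {real_of_ereal (xstar \<mu>)} = 0) \<and>
     (xstar \<mu> < \<infinity> \<or>
      (xstar \<mu> = \<infinity> \<and> (\<forall>t. Lambda1 \<mu> t < \<infinity>)) \<or>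
      (xstar \<mu> = \<infinity> \<and> bounded {t. Lambda1 \<mu> t < \<infinity>} \<and> log_concave_measure \<mu>))"

definition Lambda_star_condition :: "real measure \<Rightarrow> bool" where
  "Lambda_star_condition \<mu> \<longleftrightarrow>
     ((\<lambda>x. - ln (measure \<mu> {x..}) / real_of_ereal (Lambda1_star \<mu> x)) \<longlongrightarrow> 1)
       (if xstar \<mu> = \<infinity> then at_top else at_left (real_of_ereal (xstar \<mu>)))"

end

theory Submission
  imports Defs "HOL-Real_Asymp.Real_Asymp"
begin

text \<open>By symmetry one has to bound below the probability of \<open>\<Sum>c i * (s i * z i - \<bar>x i\<bar>) \<ge> 0\<close> with
  \<open>c i \<ge> 0\<close> and signs \<open>s i\<close>. Replace the law of each coordinate by a tilted one. If \<open>\<bar>x i\<bar>\<close> is close to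
  the right end of the support, condition on \<open>s i * z \<ge> \<bar>x i\<bar>\<close>; by the \<open>\<Lambda>\<^sup>*\<close>-condition this costs entropy
  \<open>(1 + \<epsilon>) * \<Lambda>\<^sup>*(x i)\<close>. Otherwise use an exponential tilt of a truncation of \<open>\<mu>\<close> with mean
  strictly above \<open>\<bar>x i\<bar>\<close>, at entropy \<open>\<Lambda>\<^sup>*(x i) + \<delta>\<close>; by compactness and lower semicontinuity of \<open>\<Lambda>\<^sup>*\<close>
  finitely many such tilts suffice. Under the tilted product law the sum is
  dominated from below by a variable bounded by \<open>R\<close> with mean at least \<open>\<theta> * R\<close>, hence nonnegative with
  probability at least \<open>\<theta>\<close>, whatever the weights. Since the log-density concentrates around the
  total entropy (Hoeffding), changing back to \<open>\<mu>\<close> costs \<open>exp (- (1 + \<epsilon>) * r - O(\<delta>) * n)\<close>.\<close>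

section \<open>Lower bounds by change of measure\<close>

text \<open>Both sides agree on boxes, where the integral of a product of one-coordinate functions
  factorises. This turns coordinatewise tilting into an explicit density against the original
  product law.\<close>

lemma PiM_density:
  fixes M :: "'i \<Rightarrow> 'a measure" and f :: "'i \<Rightarrow> 'a \<Rightarrow> ennreal"
  assumes "finite I" and M: "\<And>i. prob_space (M i)"
    and f [measurable]: "\<And>i. f i \<in> borel_measurable (M i)"
    and fM: "\<And>i. prob_space (density (M i) (f i))"
  shows "Pi\<^sub>M I (\<lambda>i. density (M i) (f i)) = density (Pi\<^sub>M I M) (\<lambda>z. \<Prod>i\<in>I. f i (z i))"
proof -
  interpret M: product_prob_space M I
    by (intro product_prob_spaceI M)
  interpret N: product_prob_space "\<lambda>i. density (M i) (f i)" I
    by (intro product_prob_spaceI fM)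
  show ?thesis
  proof (rule N.PiM_eqI[symmetric])
    show "sets (density (Pi\<^sub>M I M) (\<lambda>z. \<Prod>i\<in>I. f i (z i))) = sets (Pi\<^sub>M I (\<lambda>i. density (M i) (f i)))"
      by (simp cong: sets_PiM_cong)
    fix A assume A: "\<And>i. i \<in> I \<Longrightarrow> A i \<in> sets (density (M i) (f i))"
    then have A' [measurable]: "\<And>i. i \<in> I \<Longrightarrow> A i \<in> sets (M i)"
      by simp
    have "emeasure (density (Pi\<^sub>M I M) (\<lambda>z. \<Prod>i\<in>I. f i (z i))) (Pi\<^sub>E I A)
      = (\<integral>\<^sup>+z. (\<Prod>i\<in>I. f i (z i)) * indicator (Pi\<^sub>E I A) z \<partial>Pi\<^sub>M I M)"
      using \<open>finite I\<close> by (intro emeasure_density) (auto intro!: sets_PiM_I_finite)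
    also have "\<dots> = (\<integral>\<^sup>+z. (\<Prod>i\<in>I. f i (z i) * indicator (A i) (z i)) \<partial>Pi\<^sub>M I M)"
    proof (intro nn_integral_cong)
      fix z assume z: "z \<in> space (Pi\<^sub>M I M)"
      have "indicator (Pi\<^sub>E I A) z = (\<Prod>i\<in>I. indicator (A i) (z i) :: ennreal)"
        using z \<open>finite I\<close> by (auto simp: indicator_def space_PiM PiE_iff)
      then show "(\<Prod>i\<in>I. f i (z i)) * indicator (Pi\<^sub>E I A) z = (\<Prod>i\<in>I. f i (z i) * indicator (A i) (z i))"
        by (simp add: prod.distrib)
    qed
    also have "\<dots> = (\<Prod>i\<in>I. \<integral>\<^sup>+z. f i z * indicator (A i) z \<partial>M i)"
      using \<open>finite I\<close> by (intro M.product_nn_integral_prod) auto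
    also have "\<dots> = (\<Prod>i\<in>I. emeasure (density (M i) (f i)) (A i))"
      by (intro prod.cong refl emeasure_density[symmetric]) auto
    finally show "emeasure (density (Pi\<^sub>M I M) (\<lambda>z. \<Prod>i\<in>I. f i (z i))) (Pi\<^sub>E I A) = 
      (\<Prod>i\<in>I. emeasure (density (M i) (f i)) (A i))" .
  qed fact
qed

text \<open>Supplies the independence that Hoeffding's inequality asks for: the joint law of the
  coordinates is the product measure itself.\<close>

lemma (in product_prob_space) indep_vars_components:
  assumes "I \<noteq> {}"
  shows "P.indep_vars M (\<lambda>i z. z i) I"
proof -
  have "distr (Pi\<^sub>M I M) (Pi\<^sub>M I M) (\<lambda>z. \<lambda>i\<in>I. z i) = distr (Pi\<^sub>M I M) (Pi\<^sub>M I M) (\<lambda>z. z)"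
    by (intro distr_cong) (auto simp: space_PiM PiE_iff extensional_def restrict_def)
  also have "\<dots> = Pi\<^sub>M I (\<lambda>i. distr (Pi\<^sub>M I M) (M i) (\<lambda>z. z i))"
    by (simp add: distr_id2 PiM_component cong: PiM_cong)
  finally show ?thesis
    using assms by (subst P.indep_vars_iff_distr_eq_PiM') auto
qed

text \<open>A variable bounded by \<open>R\<close> is at most \<open>R\<close> times the indicator
  of the event that it is nonnegative; take expectations. Only the ratio of mean to bound enters, so
  rescaling \<open>S\<close> changes nothing.\<close>

lemma (in prob_space) prob_nonneg_ge:
  fixes R \<theta> :: real
  assumes S [measurable]: "S \<in> borel_measurable M"
    and bound: "\<And>z. \<bar>S z\<bar> \<le> R" and mean: "\<theta> * R \<le> expectation S" and "\<theta> \<le> 1"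
  shows "\<theta> \<le> prob {z \<in> space M. 0 \<le> S z}"
proof -
  have int: "integrable M S"
    using bound by (intro integrable_const_bound[where B=R]) auto
  have "0 \<le> R"
    using bound[of undefined] by linarith
  show ?thesis
  proof (cases "R = 0")
    case True
    then have "{z \<in> space M. 0 \<le> S z} = space M"
      using bound by auto
    then show ?thesis
      using \<open>\<theta> \<le> 1\<close> by (simp add: prob_space)
  next
    case False
    have "\<theta> * R \<le> expectation S" by fact
    also have "\<dots> \<le> expectation (\<lambda>z. R * indicator {z \<in> space M. 0 \<le> S z} z)"
    proof (intro integral_mono int)
      show "integrable M (\<lambda>z. R * indicator {z \<in> space M. 0 \<le> S z} z)"
        by (intro integrable_mult_right integrable_real_indicator) (auto simp: emeasure_eq_measure)
      show "S z \<le> R * indicator {z \<in> space M. 0 \<le> S z} z" if "z \<in> space M" for z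
        using bound[of z] \<open>0 \<le> R\<close> that by (auto simp: indicator_def abs_le_iff)
    qed
    also have "\<dots> = prob {z \<in> space M. 0 \<le> S z} * R"
      by simp
    finally show ?thesis
      using \<open>0 \<le> R\<close> False by simp
  qed
qed

text \<open>Outside an event that Hoeffding's inequality makes negligible, the density of the product of
  the tilted laws is at most \<open>exp (\<Sum>H + \<delta> * n)\<close>. Coordinates with \<open>\<kappa> i = 0\<close> are those whose
  tilted law is supported on \<open>x i \<le> s i * z\<close>.\<close>

lemma halfspace_measure_ge_tilt:
  fixes \<mu> :: "real measure" and f h g :: "nat \<Rightarrow> real \<Rightarrow> real" and H \<kappa> c s x :: "nat \<Rightarrow> real"
    and \<theta> B \<delta> :: real and n :: nat
  assumes \<mu>: "prob_space \<mu>" and sets_\<mu> [measurable_cong]: "sets \<mu> = sets borel"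
    and meas [measurable]: "\<And>i. f i \<in> borel_measurable borel" "\<And>i. h i \<in> borel_measurable borel"
      "\<And>i. g i \<in> borel_measurable borel"
    and f: "\<And>i z. 0 \<le> f i z" "\<And>i z. f i z \<le> exp (h i z)" "\<And>i. (\<integral>\<^sup>+z. f i z \<partial>\<mu>) = 1"
    and h: "\<And>i z. \<bar>h i z - H i\<bar> \<le> B" "\<And>i. (\<integral>z. f i z * h i z \<partial>\<mu>) = H i"
    and g: "\<And>i z. \<bar>g i z\<bar> \<le> \<kappa> i" "\<And>i z. f i z \<noteq> 0 \<Longrightarrow> g i z \<le> s i * z - x i"
      "\<And>i. \<theta> * \<kappa> i \<le> (\<integral>z. f i z * g i z \<partial>\<mu>)"
    and c: "\<And>i. 0 \<le> c i" and "\<theta> \<le> 1" "0 < B" "0 < \<delta>" "1 \<le> n"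
  shows "exp (- (\<Sum>i<n. H i) - \<delta> * n) * (\<theta> - exp (- (\<delta>\<^sup>2 * n / (2 * B\<^sup>2))))
    \<le> measure (Pi\<^sub>M {..<n} (\<lambda>_. \<mu>))
        {z \<in> space (Pi\<^sub>M {..<n} (\<lambda>_. \<mu>)). (\<Sum>i<n. c i * x i) \<le> (\<Sum>i<n. c i * (s i * z i))}"
    (is "_ \<le> measure ?P ?A")
proof -
  define N where "N i = density \<mu> (\<lambda>z. ennreal (f i z))" for i
  have N: "prob_space (N i)" for i
    using f(3) by (intro prob_spaceI) (simp add: N_def emeasure_density cong: nn_integral_cong)
  have sets_N [measurable_cong]: "sets (N i) = sets borel" for i
    by (simp add: N_def sets_\<mu>)
  interpret \<mu>: prob_space \<mu> by fact
  interpret P: product_prob_space "\<lambda>_. \<mu>" "{..<n}"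
    by (intro product_prob_spaceI \<mu>)
  interpret Q: product_prob_space N "{..<n}"
    by (intro product_prob_spaceI N)
  let ?Q = "Pi\<^sub>M {..<n} N"
  have Q_density: "?Q = density ?P (\<lambda>z. \<Prod>i<n. ennreal (f i (z i)))"
    unfolding N_def using N by (intro PiM_density \<mu>) (auto simp: N_def)
  have sets_Q: "sets ?Q = sets ?P" and space_Q: "space ?Q = space ?P"
    by (simp_all add: Q_density)
  have int_component: "(\<integral>z. u (z i) \<partial>?Q) = (\<integral>z. f i z * u z \<partial>\<mu>)"
    if [measurable]: "u \<in> borel_measurable borel" and "i < n" for u :: "real \<Rightarrow> real" and i
  proof -
    have "(\<integral>z. u (z i) \<partial>?Q) = (\<integral>z. u z \<partial>distr ?Q (N i) (\<lambda>z. z i))"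
      using \<open>i < n\<close> by (intro integral_distr[symmetric]) auto
    also have "\<dots> = (\<integral>z. u z \<partial>N i)"
      using \<open>i < n\<close> by (simp add: Q.PiM_component)
    also have "\<dots> = (\<integral>z. f i z * u z \<partial>\<mu>)"
      unfolding N_def using f(1) by (subst integral_density) auto
    finally show ?thesis .
  qed
  \<comment> \<open>\<open>D\<close> is the rare event that the bound on the log-density exceeds the
    total entropy by \<delta>n; on \<open>E\<close> the bounded minorant of the weighted sum is
    nonnegative.\<close>
  define D where "D = {z \<in> space ?Q. (\<Sum>i<n. h i (z i)) \<ge> (\<Sum>i<n. H i) + \<delta> * n}"
  define E where "E = {z \<in> space ?Q. 0 \<le> (\<Sum>i<n. c i * g i (z i))}"
  have [measurable]: "D \<in> sets ?Q" "E \<in> sets ?Q"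
    unfolding D_def E_def by measurable
  have [measurable]: "?A \<in> sets ?P"
    by measurable
  have "Q.P.indep_vars (\<lambda>_. borel) (\<lambda>i z. h i (z i)) {..<n}"
    using \<open>1 \<le> n\<close> by (intro Q.P.indep_vars_compose2[OF Q.indep_vars_components]) (auto simp: lessThan_empty_iff)
  then interpret HQ: Hoeffding_ineq ?Q "{..<n}" "\<lambda>i z. h i (z i)" "\<lambda>i. H i - B" "\<lambda>i. H i + B"
      "\<Sum>i<n. Q.P.expectation (\<lambda>z. h i (z i))"
    using h(1) by unfold_locales (auto simp: abs_le_iff algebra_simps)
  \<comment> \<open>Each summand ranges over an interval of length 2B, so the Hoeffding exponent is
    2(\<delta>n)^2 / (4nB^2).\<close>
  have "Q.P.prob D \<le> exp (- 2 * (\<delta> * n)\<^sup>2 / (\<Sum>i<n. ((H i + B) - (H i - B))\<^sup>2))"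
    using HQ.Hoeffding_ineq_ge[of "\<delta> * n"] \<open>0 < B\<close> \<open>0 < \<delta>\<close> \<open>1 \<le> n\<close>
    by (simp add: D_def int_component h(2))
  also have "- 2 * (\<delta> * n)\<^sup>2 / (\<Sum>i<n. ((H i + B) - (H i - B))\<^sup>2) = - (\<delta>\<^sup>2 * n / (2 * B\<^sup>2))"
    using \<open>0 < B\<close> \<open>1 \<le> n\<close> by (simp add: field_simps power2_eq_square)
  finally have D: "Q.P.prob D \<le> exp (- (\<delta>\<^sup>2 * n / (2 * B\<^sup>2)))" .
  have int_g: "integrable ?Q (\<lambda>z. g i (z i))" if "i < n" for i
    using g(1) that by (intro Q.P.integrable_const_bound[where B="\<kappa> i"]) auto
  have E: "\<theta> \<le> Q.P.prob E"
    unfolding E_def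
  \<comment> \<open>Mean and bound of the minorant are linear in the weights \<open>c\<close>, so a
    coordinatewise ratio \<theta> survives any nonnegative weighting.\<close>
  proof (rule Q.P.prob_nonneg_ge[where R="\<Sum>i<n. c i * \<kappa> i"])
    show "\<bar>\<Sum>i<n. c i * g i (z i)\<bar> \<le> (\<Sum>i<n. c i * \<kappa> i)" for z
      using g(1) c by (intro order_trans[OF sum_abs] sum_mono) (auto simp: abs_mult intro!: mult_left_mono)
    have "\<theta> * (\<Sum>i<n. c i * \<kappa> i) = (\<Sum>i<n. c i * (\<theta> * \<kappa> i))"
      by (simp add: sum_distrib_left mult_ac)
    also have "\<dots> \<le> (\<Sum>i<n. c i * (\<integral>z. f i z * g i z \<partial>\<mu>))"
      by (intro sum_mono mult_left_mono g c)
    also have "\<dots> = Q.P.expectation (\<lambda>z. \<Sum>i<n. c i * g i (z i))"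
      using int_g by (subst Bochner_Integration.integral_sum) (auto simp: int_component)
    finally show "\<theta> * (\<Sum>i<n. c i * \<kappa> i) \<le> Q.P.expectation (\<lambda>z. \<Sum>i<n. c i * g i (z i))" .
  qed (use \<open>\<theta> \<le> 1\<close> in measurable)
  \<comment> \<open>\<open>D\<close> and \<open>E\<close> may be dependent; the union bound is
    enough because \<open>D\<close> is exponentially small.\<close>
  have "Q.P.prob E \<le> Q.P.prob ((E - D) \<union> D)"
    by (intro Q.P.finite_measure_mono) auto
  also have "\<dots> \<le> Q.P.prob (E - D) + Q.P.prob D"
    by (intro measure_Un_le) auto
  finally have "Q.P.prob E \<le> Q.P.prob (E - D) + Q.P.prob D" .
  with D E have ED: "\<theta> - exp (- (\<delta>\<^sup>2 * n / (2 * B\<^sup>2))) \<le> Q.P.prob (E - D)"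
    by linarith
  let ?e = "exp ((\<Sum>i<n. H i) + \<delta> * n)"
  have "emeasure ?Q (E - D) = (\<integral>\<^sup>+z. (\<Prod>i<n. ennreal (f i (z i))) * indicator (E - D) z \<partial>?P)"
    unfolding Q_density by (rule emeasure_density) (auto simp flip: sets_Q)
  also have "\<dots> \<le> (\<integral>\<^sup>+z. ennreal ?e * indicator ?A z \<partial>?P)"
  proof (intro nn_integral_mono)
    fix z assume z: "z \<in> space ?P"
    show "(\<Prod>i<n. ennreal (f i (z i))) * indicator (E - D) z \<le> ennreal ?e * indicator ?A z"
    \<comment> \<open>A vanishing factor makes the left side 0. Otherwise \<open>g\<close> lies
      below \<open>s i * z - x i\<close> in every coordinate, so \<open>E\<close> puts the point
      into \<open>?A\<close>, while staying outside \<open>D\<close> bounds the density by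
      \<open>?e\<close>.\<close>
    proof (cases "z \<in> E - D \<and> (\<forall>i<n. f i (z i) \<noteq> 0)")
      case True
      have "0 \<le> (\<Sum>i<n. c i * g i (z i))"
        using True by (auto simp: E_def)
      also have "\<dots> \<le> (\<Sum>i<n. c i * (s i * z i - x i))"
        using True by (intro sum_mono mult_left_mono c g(2)) auto
      finally have "z \<in> ?A"
        using z by (simp add: algebra_simps sum_subtractf)
      have "(\<Prod>i<n. f i (z i)) \<le> (\<Prod>i<n. exp (h i (z i)))"
        using f by (intro prod_mono) auto
      also have "\<dots> = exp (\<Sum>i<n. h i (z i))"
        by (simp add: exp_sum)
      also have "\<dots> \<le> ?e"
        using True by (auto simp: D_def E_def)
      finally show ?thesis
        using \<open>z \<in> ?A\<close> f(1) by (auto simp: prod_ennreal indicator_def intro!: ennreal_leI)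
    next
      case False
      then have "(\<Prod>i<n. ennreal (f i (z i))) * indicator (E - D) z = 0"
        by (force simp: indicator_def)
      then show ?thesis by (simp only: zero_le)
    qed
  qed
  also have "\<dots> = ennreal ?e * emeasure ?P ?A"
    by (rule nn_integral_cmult_indicator) measurable
  also have "\<dots> = ennreal (?e * measure ?P ?A)"
    by (simp add: P.P.emeasure_eq_measure ennreal_mult'')
  finally have "Q.P.prob (E - D) \<le> ?e * measure ?P ?A"
    by (simp add: Q.P.emeasure_eq_measure)
  with ED have "\<theta> - exp (- (\<delta>\<^sup>2 * n / (2 * B\<^sup>2))) \<le> ?e * measure ?P ?A"
    by linarith
  then have "exp (- (\<Sum>i<n. H i) - \<delta> * n) * (\<theta> - exp (- (\<delta>\<^sup>2 * n / (2 * B\<^sup>2))))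
      \<le> exp (- (\<Sum>i<n. H i) - \<delta> * n) * (?e * measure ?P ?A)"
    by (rule mult_left_mono) simp
  also have "\<dots> = measure ?P ?A"
    by (simp add: mult.assoc[symmetric] flip: exp_add)
  finally show ?thesis .
qed

section \<open>Cramer transforms\<close>

text \<open>A positive function has nonzero integral under a probability measure, so
  \<open>ln\<close> is never evaluated at 0 and the logarithm can be undone.\<close>

lemma log_mgf_eq_ereal_iff:
  assumes "prob_space M" and [measurable]: "f \<in> borel_measurable M"
  shows "log_mgf M f = ereal l \<longleftrightarrow> (\<integral>\<^sup>+z. ennreal (exp (f z)) \<partial>M) = ennreal (exp l)"
proof -
  interpret prob_space M by fact
  let ?I = "\<integral>\<^sup>+z. ennreal (exp (f z)) \<partial>M"
  have "?I \<noteq> 0"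
    by (subst nn_integral_0_iff_AE) (auto simp: AE_False)
  show ?thesis
  proof (cases "?I = \<infinity>")
    case True
    then show ?thesis by (simp add: log_mgf_def)
  next
    case False
    then obtain q where q: "?I = ennreal q" "0 \<le> q"
      by (cases ?I) auto
    with \<open>?I \<noteq> 0\<close> have "0 < q" by (cases "q = 0") auto
    then show ?thesis
      using q by (auto simp: log_mgf_def Let_def)
  qed
qed

lemma log_mgf_cases:
  obtains "log_mgf M f = \<infinity>" | l where "log_mgf M f = ereal l"
  by (cases "(\<integral>\<^sup>+z. ennreal (exp (f z)) \<partial>M) = \<infinity>") (auto simp: log_mgf_def Let_def)

lemma Lambda1_star_nonneg:
  assumes "prob_space \<mu>"
  shows "0 \<le> Lambda1_star \<mu> x"
proof -
  interpret prob_space \<mu> by fact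
  have "Lambda1 \<mu> 0 = ereal 0"
    by (simp add: Lambda1_def log_mgf_def emeasure_space_1 zero_ereal_def)
  then have "0 = ereal (0 * x) - Lambda1 \<mu> 0"
    by (simp add: zero_ereal_def)
  also have "\<dots> \<le> Lambda1_star \<mu> x"
    unfolding Lambda1_star_def by (rule SUP_upper) simp
  finally show ?thesis .
qed

text \<open>The integral of \<open>exp (t * (z - x))\<close> is exp(\<Lambda>(t) - tx), so a single
  slope certifies the bound. Finiteness of \<open>Lambda1\<close> at \<open>t\<close> follows from
  the hypothesis, which suits slopes found as limits.\<close>

lemma Lambda1_star_ge:
  assumes "prob_space \<mu>" and [measurable_cong]: "sets \<mu> = sets borel"
    and q: "0 < q" "(\<integral>\<^sup>+z. ennreal (exp (t * (z - x))) \<partial>\<mu>) \<le> ennreal q"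
  shows "ereal (- ln q) \<le> Lambda1_star \<mu> x"
proof -
  interpret prob_space \<mu> by fact
  have "(\<integral>\<^sup>+z. ennreal (exp (t * z)) \<partial>\<mu>) = (\<integral>\<^sup>+z. ennreal (exp (t * x)) * ennreal (exp (t * (z - x))) \<partial>\<mu>)"
    by (intro nn_integral_cong) (simp add: algebra_simps flip: ennreal_mult exp_add)
  also have "\<dots> = ennreal (exp (t * x)) * (\<integral>\<^sup>+z. ennreal (exp (t * (z - x))) \<partial>\<mu>)"
    by (rule nn_integral_cmult) measurable
  also have "\<dots> \<le> ennreal (exp (t * x)) * ennreal q"
    by (intro mult_left_mono q) simp
  also have "\<dots> = ennreal (exp (t * x + ln q))"
    using q(1) by (simp add: exp_add flip: ennreal_mult)
  finally have le: "(\<integral>\<^sup>+z. ennreal (exp (t * z)) \<partial>\<mu>) \<le> ennreal (exp (t * x + ln q))" .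
  obtain l where l: "Lambda1 \<mu> t = ereal l"
    using le by (cases rule: log_mgf_cases[of \<mu> "\<lambda>x. t * x"])
      (auto simp: Lambda1_def log_mgf_def Let_def top_unique split: if_splits)
  then have "(\<integral>\<^sup>+z. ennreal (exp (t * z)) \<partial>\<mu>) = ennreal (exp l)"
    unfolding Lambda1_def using assms(1) by (subst (asm) log_mgf_eq_ereal_iff) auto
  with le have "l \<le> t * x + ln q"
    by simp
  then have "ereal (- ln q) \<le> ereal (t * x) - Lambda1 \<mu> t"
    by (simp add: l)
  also have "\<dots> \<le> Lambda1_star \<mu> x"
    unfolding Lambda1_star_def by (rule SUP_upper) simp
  finally show ?thesis .
qed

lemma less_Lambda1_starE:
  assumes "ereal a < Lambda1_star \<mu> x"
  obtains t l where "Lambda1 \<mu> t = ereal l" "a < t * x - l"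
proof -
  from assms obtain t where t: "ereal a < ereal (t * x) - Lambda1 \<mu> t"
    unfolding Lambda1_star_def less_SUP_iff by auto
  show thesis
  proof (cases rule: log_mgf_cases[of \<mu> "\<lambda>x. t * x"])
    case 1
    with t show thesis by (simp add: Lambda1_def)
  next
    case (2 l)
    with t show thesis by (intro that[of t l]) (auto simp: Lambda1_def)
  qed
qed

lemma Lambda1_star_ge_affine:
  "Lambda1 \<mu> t = ereal l \<Longrightarrow> ereal (t * x - l) \<le> Lambda1_star \<mu> x"
  unfolding Lambda1_star_def by (rule SUP_upper2[of t]) auto

lemma LambdaN_eq_sum:
  assumes \<mu>: "prob_space \<mu>" and [measurable_cong]: "sets \<mu> = sets borel"
    and l: "\<And>i. i < n \<Longrightarrow> Lambda1 \<mu> (t i) = ereal (l i)"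
  shows "LambdaN n \<mu> t = ereal (\<Sum>i<n. l i)"
proof -
  interpret P: product_prob_space "\<lambda>_. \<mu>" "{..<n}"
    by (intro product_prob_spaceI \<mu>)
  have I: "(\<integral>\<^sup>+z. ennreal (exp (t i * z)) \<partial>\<mu>) = ennreal (exp (l i))" if "i < n" for i
    using l[OF that] \<mu> unfolding Lambda1_def by (subst (asm) log_mgf_eq_ereal_iff) auto
  have "(\<integral>\<^sup>+z. ennreal (exp (inner_n n t z)) \<partial>mu_n n \<mu>)
      = (\<integral>\<^sup>+z. (\<Prod>i<n. ennreal (exp (t i * z i))) \<partial>Pi\<^sub>M {..<n} (\<lambda>_. \<mu>))"
    by (simp add: inner_n_def mu_n_def exp_sum prod_ennreal)
  also have "\<dots> = (\<Prod>i<n. \<integral>\<^sup>+z. ennreal (exp (t i * z)) \<partial>\<mu>)"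
    by (rule P.product_nn_integral_prod) auto
  also have "\<dots> = ennreal (exp (\<Sum>i<n. l i))"
    by (simp add: I prod_ennreal exp_sum)
  finally show ?thesis
    unfolding LambdaN_def using P.P.prob_space_axioms
    by (subst log_mgf_eq_ereal_iff) (auto simp: mu_n_def inner_n_def[abs_def])
qed

lemma B_r_Lambda1_star:
  assumes \<mu>: "prob_space \<mu>" "sets \<mu> = sets borel" and x: "x \<in> B_r n \<mu> r"
  obtains a where "\<And>i. i < n \<Longrightarrow> Lambda1_star \<mu> (x i) = ereal (a i)" "\<And>i. i < n \<Longrightarrow> 0 \<le> a i"
    "(\<Sum>i<n. a i) \<le> r"
proof -
  have sum_le: "(\<Sum>i<n. b i) \<le> r" if b: "\<And>i. i < n \<Longrightarrow> ereal (b i) < Lambda1_star \<mu> (x i)" for b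
  proof -
    have "\<exists>t l. Lambda1 \<mu> t = ereal l \<and> b i < t * x i - l" if "i < n" for i
      using less_Lambda1_starE[OF b[OF that]] by metis
    then obtain t l where tl: "\<And>i. i < n \<Longrightarrow> Lambda1 \<mu> (t i) = ereal (l i)"
        "\<And>i. i < n \<Longrightarrow> b i < t i * x i - l i"
      by metis
    have "ereal (\<Sum>i<n. t i * x i - l i) = ereal (inner_n n x t) - LambdaN n \<mu> t"
      using LambdaN_eq_sum[OF \<mu> tl(1)] by (simp add: inner_n_def sum_subtractf mult.commute)
    also have "\<dots> \<le> LambdaN_star n \<mu> x"
      unfolding LambdaN_star_def by (rule SUP_upper) simp
    also have "\<dots> \<le> ereal r"
      using x by (simp add: B_r_def)
    finally have "(\<Sum>i<n. t i * x i - l i) \<le> r"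
      by simp
    moreover have "(\<Sum>i<n. b i) \<le> (\<Sum>i<n. t i * x i - l i)"
      using tl(2) by (intro sum_mono) (auto intro: less_imp_le)
    ultimately show ?thesis by linarith
  qed
  note nonneg = Lambda1_star_nonneg[OF \<mu>(1)]
  have fin: "Lambda1_star \<mu> (x j) \<noteq> \<infinity>" if "j < n" for j
  proof
    assume inf: "Lambda1_star \<mu> (x j) = \<infinity>"
    \<comment> \<open>If coordinate \<open>j\<close> were infinite, this choice would sum to r + n +
      1 - (n - 1) > r. The value -1 is strictly below every transform, as these are
      nonnegative.\<close>
    define b where "b i = (if i = j then r + real n + 1 else - 1)" for i
    have "ereal (b i) < Lambda1_star \<mu> (x i)" if "i < n" for i
      using nonneg[of "x i"] inf less_le_trans[OF _ nonneg[of "x i"], of "ereal (-1)"]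
      by (auto simp: b_def)
    then have "(\<Sum>i<n. b i) \<le> r" by (rule sum_le)
    moreover have "(\<Sum>i<n. b i) = b j + (\<Sum>i\<in>{..<n} - {j}. b i)"
      using that by (intro sum.remove) auto
    moreover have "(\<Sum>i\<in>{..<n} - {j}. b i) = - real (n - 1)"
      using that by (simp add: b_def)
    ultimately show False
      using that by (simp add: b_def of_nat_diff)
  qed
  define a where "a i = real_of_ereal (Lambda1_star \<mu> (x i))" for i
  have a: "Lambda1_star \<mu> (x i) = ereal (a i)" if "i < n" for i
    using fin[OF that] nonneg[of "x i"] by (auto simp: a_def ereal_real')
  show thesis
  proof (rule that[of a])
    show "0 \<le> a i" if "i < n" for i
      using nonneg[of "x i"] by (simp add: a_def real_of_ereal_pos)
    show "(\<Sum>i<n. a i) \<le> r"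
    proof (rule field_le_epsilon)
      fix e :: real assume "0 < e"
      \<comment> \<open>\<open>sum_le\<close> needs strict inequalities; this reduction costs at
        most \<open>e\<close> in total and is also defined for n = 0.\<close>
      have "(\<Sum>i<n. a i - e / (real n + 1)) \<le> r"
        using \<open>0 < e\<close> by (intro sum_le) (simp add: a)
      moreover have "real n * (e / (real n + 1)) \<le> e"
        using \<open>0 < e\<close> by (simp add: field_simps)
      ultimately show "(\<Sum>i<n. a i) \<le> r + e"
        by (simp add: sum_subtractf)
    qed
  qed (use a in auto)
qed

section \<open>Even laws on the line\<close>

locale even_law = prob_space \<mu> for \<mu> :: "real measure" +
  assumes sets_\<mu> [measurable_cong, simp]: "sets \<mu> = sets borel"
    and even: "even_measure \<mu>"
begin

lemma space_\<mu> [simp]: "space \<mu> = UNIV"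
  using sets_eq_imp_space_eq[OF sets_\<mu>] by simp

lemma distr_uminus: "distr \<mu> borel uminus = \<mu>"
proof (rule measure_eqI)
  fix A :: "real set" assume "A \<in> sets (distr \<mu> borel uminus)"
  then have [measurable]: "A \<in> sets borel" by simp
  have "uminus -` A = uminus ` A"
    by (force simp: image_iff)
  moreover have "measure \<mu> (uminus ` A) = measure \<mu> A"
    using even by (auto simp: even_measure_def)
  ultimately show "emeasure (distr \<mu> borel uminus) A = emeasure \<mu> A"
    by (simp add: emeasure_distr emeasure_eq_measure)
qed simp

lemma nn_integral_uminus:
  assumes [measurable]: "f \<in> borel_measurable borel"
  shows "(\<integral>\<^sup>+z. f (- z) \<partial>\<mu>) = (\<integral>\<^sup>+z. f z \<partial>\<mu>)"
proof -
  have "(\<integral>\<^sup>+z. f z \<partial>\<mu>) = (\<integral>\<^sup>+z. f z \<partial>distr \<mu> borel uminus)"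
    by (simp add: distr_uminus)
  also have "\<dots> = (\<integral>\<^sup>+z. f (- z) \<partial>\<mu>)"
    by (rule nn_integral_distr) measurable
  finally show ?thesis ..
qed

lemma integral_uminus:
  fixes f :: "real \<Rightarrow> real"
  assumes [measurable]: "f \<in> borel_measurable borel"
  shows "(\<integral>z. f (- z) \<partial>\<mu>) = (\<integral>z. f z \<partial>\<mu>)"
proof -
  have "(\<integral>z. f z \<partial>\<mu>) = (\<integral>z. f z \<partial>distr \<mu> borel uminus)"
    by (simp add: distr_uminus)
  also have "\<dots> = (\<integral>z. f (- z) \<partial>\<mu>)"
    by (rule integral_distr) measurable
  finally show ?thesis ..
qed

lemma Lambda1_uminus: "Lambda1 \<mu> (- t) = Lambda1 \<mu> t"
  using nn_integral_uminus[of "\<lambda>z. ennreal (exp (t * z))"] by (simp add: Lambda1_def log_mgf_def)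

lemma Lambda1_star_abs: "Lambda1_star \<mu> \<bar>x\<bar> = Lambda1_star \<mu> x"
proof -
  have le: "Lambda1_star \<mu> (- x) \<le> Lambda1_star \<mu> x" for x
    unfolding Lambda1_star_def
    by (rule SUP_mono, rule bexI[of _ "- t" for t]) (auto simp: Lambda1_uminus)
  show ?thesis
    using le[of x] le[of "- x"] by (auto simp: abs_if)
qed

lemma measure_pos_if_less_xstar:
  assumes "ereal x < xstar \<mu>"
  shows "0 < measure \<mu> {x..}"
proof -
  from assms obtain w where w: "x < w" "0 < measure \<mu> {w..}"
    by (auto simp: xstar_def less_Sup_iff)
  have "measure \<mu> {w..} \<le> measure \<mu> {x..}"
    using w by (intro finite_measure_mono) auto
  with w show ?thesis by linarith
qed

text \<open>The two closed half-lines at 0 cover the line and have equal mass by evenness, so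
  neither is null.\<close>

lemma xstar_nonneg: "0 \<le> xstar \<mu>"
proof -
  have "1 = measure \<mu> ({0..} \<union> {..0})"
  proof -
    have "{0..} \<union> {..0} = (UNIV :: real set)" by auto
    then show ?thesis using prob_space by simp
  qed
  also have "\<dots> \<le> measure \<mu> {0..} + measure \<mu> {..0}"
    by (intro measure_Un_le) auto
  also have "{..0::real} = uminus ` {0..}"
    by simp
  also have "measure \<mu> (uminus ` {0..}) = measure \<mu> {0..}"
    using bspec[OF even[unfolded even_measure_def], of "{0..}"] by simp
  finally have "0 < measure \<mu> {0..}" by linarith
  then show ?thesis
    unfolding xstar_def by (intro Sup_upper) (auto simp: zero_ereal_def)
qed

text \<open>If the right end b of the support is finite and carries no atom, then z < b almost
  surely, so the integrals of exp(n(z - b)) tend to 0 by dominated convergence. Hence the transform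
  is infinite at every x \<ge> b.\<close>

lemma less_xstar_if_Lambda1_star_finite:
  assumes fin: "Lambda1_star \<mu> x \<noteq> \<infinity>"
    and atom: "xstar \<mu> < \<infinity> \<Longrightarrow> measure \<mu> {real_of_ereal (xstar \<mu>)} = 0"
  shows "ereal x < xstar \<mu>"
proof (rule ccontr)
  assume "\<not> ?thesis"
  then have "xstar \<mu> \<le> ereal x" by simp
  with xstar_nonneg obtain b where b: "xstar \<mu> = ereal b"
    by (cases "xstar \<mu>") auto
  then have "b \<le> x" and b0: "measure \<mu> {b} = 0"
    using \<open>xstar \<mu> \<le> ereal x\<close> atom by auto
  obtain a where a: "Lambda1_star \<mu> x = ereal a"
    using fin Lambda1_star_nonneg[OF prob_space_axioms, of x] by (cases "Lambda1_star \<mu> x") auto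
  have "measure \<mu> {y..} = 0" if "b < y" for y
  proof (rule ccontr)
    assume "measure \<mu> {y..} \<noteq> 0"
    then have "ereal y \<le> xstar \<mu>"
      unfolding xstar_def by (intro Sup_upper) (auto simp: less_le)
    with that b show False by simp
  qed
  then have "AE z in \<mu>. z \<notin> {b + 1 / (real n + 1)..}" for n
    by (intro AE_not_in) (auto simp: null_sets_def emeasure_eq_measure)
  then have "AE z in \<mu>. \<forall>n. z \<notin> {b + 1 / (real n + 1)..}"
    by (simp add: AE_all_countable)
  moreover have "AE z in \<mu>. z \<notin> {b}"
    using b0 by (intro AE_not_in) (auto simp: null_sets_def emeasure_eq_measure)
  ultimately have less: "AE z in \<mu>. z < b"
  proof eventually_elim
    case (elim z)
    show "z < b"
    proof (rule ccontr)
      assume "\<not> z < b"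
      with elim have "0 < z - b" by auto
      then obtain n where "inverse (real (Suc n)) < z - b"
        using reals_Archimedean by blast
      with elim(1) show False
        by (auto simp: field_simps dest!: spec[of _ n])
    qed
  qed
  have "(\<lambda>n. \<integral>z. exp (real n * (z - b)) \<partial>\<mu>) \<longlonglongrightarrow> (\<integral>z. 0 \<partial>\<mu>)"
  proof (rule integral_dominated_convergence[where w="\<lambda>_. 1"])
    show "AE z in \<mu>. (\<lambda>n. exp (real n * (z - b))) \<longlonglongrightarrow> 0"
      using less
    proof eventually_elim
      case (elim z)
      have "(\<lambda>n. exp (z - b) ^ n) \<longlonglongrightarrow> 0"
        using elim by (intro LIMSEQ_power_zero) auto
      then show ?case by (simp add: exp_of_nat_mult)
    qed
    show "AE z in \<mu>. norm (exp (real n * (z - b))) \<le> 1" for n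
      using less by eventually_elim (auto simp: mult_le_0_iff)
  qed auto
  \<comment> \<open>The threshold yields the lower bound a + 1 for a transform whose value is
    a.\<close>
  then have "eventually (\<lambda>n. (\<integral>z. exp (real n * (z - b)) \<partial>\<mu>) < exp (- a - 1)) sequentially"
    by (intro order_tendstoD) auto
  then obtain n where n: "(\<integral>z. exp (real n * (z - b)) \<partial>\<mu>) < exp (- a - 1)"
    by (auto simp: eventually_sequentially)
  have "(\<integral>\<^sup>+z. ennreal (exp (real n * (z - x))) \<partial>\<mu>) \<le> (\<integral>\<^sup>+z. ennreal (exp (real n * (z - b))) \<partial>\<mu>)"
    using \<open>b \<le> x\<close> by (intro nn_integral_mono ennreal_leI) (auto intro!: mult_left_mono)
  also have "\<dots> = ennreal (\<integral>z. exp (real n * (z - b)) \<partial>\<mu>)"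
  proof (intro nn_integral_eq_integral integrable_const_bound[where B=1])
    show "AE z in \<mu>. norm (exp (real n * (z - b))) \<le> 1"
      using less by eventually_elim (auto simp: mult_le_0_iff)
  qed auto
  also have "\<dots> \<le> ennreal (exp (- a - 1))"
    using n by (intro ennreal_leI) auto
  finally have "ereal (- ln (exp (- a - 1))) \<le> Lambda1_star \<mu> x"
    by (intro Lambda1_star_ge[OF prob_space_axioms sets_\<mu>]) auto
  then show False by (simp add: a)
qed

end

section \<open>Tilted laws\<close>

text \<open>\<open>H\<close> is the relative entropy of the law with density \<open>f\<close>. Bounding \<open>s * z - x\<close> below by a
  bounded \<open>g\<close> whose mean is a fixed fraction of its bound \<open>\<kappa>\<close> makes the later estimate independent of
  the weights of a half-space.\<close>

definition tilted :: "real measure \<Rightarrow> real \<Rightarrow> real \<Rightarrow> real \<Rightarrow> real \<Rightarrow> real \<Rightarrow> bool" where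
  "tilted \<mu> \<theta> B s x H \<longleftrightarrow> (\<exists>f h g \<kappa>.
     f \<in> borel_measurable borel \<and> h \<in> borel_measurable borel \<and> g \<in> borel_measurable borel \<and>
     (\<forall>z. 0 \<le> f z \<and> f z \<le> exp (h z) \<and> \<bar>h z - H\<bar> \<le> B \<and> \<bar>g z\<bar> \<le> \<kappa> \<and> (f z \<noteq> 0 \<longrightarrow> g z \<le> s * z - x)) \<and>
     (\<integral>\<^sup>+z. ennreal (f z) \<partial>\<mu>) = 1 \<and> (\<integral>z. f z * h z \<partial>\<mu>) = H \<and> \<theta> * \<kappa> \<le> (\<integral>z. f z * g z \<partial>\<mu>))"

lemma tilted_mono:
  assumes "tilted \<mu> \<theta> B s x H" "\<theta>' \<le> \<theta>" "B \<le> B'"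
  shows "tilted \<mu> \<theta>' B' s x H"
proof -
  obtain f h g \<kappa> where *: "f \<in> borel_measurable borel" "h \<in> borel_measurable borel" "g \<in> borel_measurable borel"
     "\<forall>z. 0 \<le> f z \<and> f z \<le> exp (h z) \<and> \<bar>h z - H\<bar> \<le> B \<and> \<bar>g z\<bar> \<le> \<kappa> \<and> (f z \<noteq> 0 \<longrightarrow> g z \<le> s * z - x)"
     "(\<integral>\<^sup>+z. ennreal (f z) \<partial>\<mu>) = 1" "(\<integral>z. f z * h z \<partial>\<mu>) = H" "\<theta> * \<kappa> \<le> (\<integral>z. f z * g z \<partial>\<mu>)"
    using assms(1) unfolding tilted_def by blast
  have "0 \<le> \<kappa>"
    using *(4)[rule_format, of 0] by linarith
  then have "\<theta>' * \<kappa> \<le> \<theta> * \<kappa>"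
    using assms(2) by (rule mult_right_mono[rotated])
  then show ?thesis
    using * assms(3) unfolding tilted_def
    by (intro exI[of _ f] exI[of _ h] exI[of _ g] exI[of _ \<kappa>]) (auto intro: order_trans)
qed

lemma (in even_law) tilted_mirror:
  assumes "tilted \<mu> \<theta> B 1 x H"
  shows "tilted \<mu> \<theta> B (- 1) x H"
proof -
  obtain f h g \<kappa> where *: "f \<in> borel_measurable borel" "h \<in> borel_measurable borel" "g \<in> borel_measurable borel"
     "\<forall>z. 0 \<le> f z \<and> f z \<le> exp (h z) \<and> \<bar>h z - H\<bar> \<le> B \<and> \<bar>g z\<bar> \<le> \<kappa> \<and> (f z \<noteq> 0 \<longrightarrow> g z \<le> 1 * z - x)"
     "(\<integral>\<^sup>+z. ennreal (f z) \<partial>\<mu>) = 1" "(\<integral>z. f z * h z \<partial>\<mu>) = H" "\<theta> * \<kappa> \<le> (\<integral>z. f z * g z \<partial>\<mu>)"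
    using assms unfolding tilted_def by blast
  note [measurable] = *(1-3)
  show ?thesis
    unfolding tilted_def
  proof (intro exI conjI)
    show "(\<lambda>z. f (- z)) \<in> borel_measurable borel" "(\<lambda>z. h (- z)) \<in> borel_measurable borel"
      "(\<lambda>z. g (- z)) \<in> borel_measurable borel"
      by measurable
    show "(\<integral>\<^sup>+z. ennreal (f (- z)) \<partial>\<mu>) = 1"
      using nn_integral_uminus[of "\<lambda>z. ennreal (f z)"] *(5) by simp
    show "(\<integral>z. f (- z) * h (- z) \<partial>\<mu>) = H"
      using integral_uminus[of "\<lambda>z. f z * h z"] *(6) by simp
    show "\<theta> * \<kappa> \<le> (\<integral>z. f (- z) * g (- z) \<partial>\<mu>)"
      using integral_uminus[of "\<lambda>z. f z * g z"] *(7) by simp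
    show "\<forall>z. 0 \<le> f (- z) \<and> f (- z) \<le> exp (h (- z)) \<and> \<bar>h (- z) - H\<bar> \<le> B \<and> \<bar>g (- z)\<bar> \<le> \<kappa> \<and>
        (f (- z) \<noteq> 0 \<longrightarrow> g (- z) \<le> - 1 * z - x)"
    proof
      fix z
      show "0 \<le> f (- z) \<and> f (- z) \<le> exp (h (- z)) \<and> \<bar>h (- z) - H\<bar> \<le> B \<and> \<bar>g (- z)\<bar> \<le> \<kappa> \<and>
        (f (- z) \<noteq> 0 \<longrightarrow> g (- z) \<le> - 1 * z - x)"
        using *(4)[rule_format, of "- z"] by simp
    qed
  qed
qed

text \<open>The law conditioned on the half-line has constant log-density, so \<open>h\<close> does
  not fluctuate, and its support lets \<open>g = 0\<close> and \<open>\<kappa> = 0\<close> serve for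
  every \<theta>. Thus no gap between mean and \<open>x\<close> is required, which makes the choice
  uniform near the end of the support.\<close>

lemma (in even_law) tilted_conditioning:
  assumes p: "0 < measure \<mu> {x..}" and "0 \<le> B"
  shows "tilted \<mu> \<theta> B 1 x (- ln (measure \<mu> {x..}))"
proof -
  let ?p = "measure \<mu> {x..}"
  show ?thesis
    unfolding tilted_def
  proof (intro exI conjI)
    show "(\<lambda>z. indicator {x..} z / ?p) \<in> borel_measurable borel" "(\<lambda>z. - ln ?p) \<in> borel_measurable borel"
      "(\<lambda>z::real. 0::real) \<in> borel_measurable borel"
      by measurable
    have "(\<integral>\<^sup>+z. ennreal (indicator {x..} z / ?p) \<partial>\<mu>) = (\<integral>\<^sup>+z. ennreal (1 / ?p) * indicator {x..} z \<partial>\<mu>)"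
      by (intro nn_integral_cong) (auto simp: indicator_def)
    also have "\<dots> = ennreal (1 / ?p) * ennreal ?p"
      by (simp add: nn_integral_cmult_indicator emeasure_eq_measure)
    also have "\<dots> = 1"
      using p by (simp flip: ennreal_mult)
    finally show "(\<integral>\<^sup>+z. ennreal (indicator {x..} z / ?p) \<partial>\<mu>) = 1" .
    show "(\<integral>z. indicator {x..} z / ?p * - ln ?p \<partial>\<mu>) = - ln ?p"
      using p by simp
    show "\<theta> * 0 \<le> (\<integral>z. indicator {x..} z / ?p * 0 \<partial>\<mu>)"
      by simp
    show "\<forall>z. 0 \<le> indicator {x..} z / ?p \<and> indicator {x..} z / ?p \<le> exp (- ln ?p) \<and>
        \<bar>- ln ?p - - ln ?p\<bar> \<le> B \<and> \<bar>0::real\<bar> \<le> 0 \<and>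
        (indicator {x..} z / ?p \<noteq> 0 \<longrightarrow> 0 \<le> 1 * z - x)"
      using p \<open>0 \<le> B\<close> by (auto simp: indicator_def exp_minus field_simps)
  qed
qed

section \<open>Critical tilts of truncated laws\<close>

context even_law
begin

text \<open>The moment generating function of \<mu> restricted to [-k, k], recentred at
  \<open>m\<close>. At its minimum over t, -ln gives the truncated analogue of the Cramer transform
  at \<open>m\<close>.\<close>

definition trunc_mgf :: "real \<Rightarrow> real \<Rightarrow> real \<Rightarrow> real" where
  "trunc_mgf k m t = (\<integral>z. indicator {- k..k} z * exp (t * (z - m)) \<partial>\<mu>)"

text \<open>The derivative of \<open>trunc_mgf k m\<close> in t. It vanishes exactly when the tilted
  truncated law, if defined, has mean \<open>m\<close>.\<close>

definition trunc_mgf' :: "real \<Rightarrow> real \<Rightarrow> real \<Rightarrow> real" where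
  "trunc_mgf' k m t = (\<integral>z. indicator {- k..k} z * ((z - m) * exp (t * (z - m))) \<partial>\<mu>)"

lemma trunc_exp_bound:
  fixes T t k m z :: real
  assumes "\<bar>t\<bar> \<le> T" "- k \<le> z" "z \<le> k"
  shows "exp (t * (z - m)) \<le> exp (T * (k + \<bar>m\<bar>))"
proof -
  have "t * (z - m) \<le> \<bar>t\<bar> * \<bar>z - m\<bar>"
    by (simp flip: abs_mult)
  also have "\<dots> \<le> T * (k + \<bar>m\<bar>)"
    using assms by (intro mult_mono) auto
  finally show ?thesis by simp
qed

lemma integrable_trunc:
  fixes c d :: real
  shows "integrable \<mu> (\<lambda>z. indicator {- k..k} z * ((c * z + d) * exp (t * (z - m))))"
proof (rule integrable_const_bound[where B="(\<bar>c\<bar> * \<bar>k\<bar> + \<bar>d\<bar>) * exp (\<bar>t\<bar> * (k + \<bar>m\<bar>))"])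
  have "norm (indicator {- k..k} z * ((c * z + d) * exp (t * (z - m))))
      \<le> (\<bar>c\<bar> * \<bar>k\<bar> + \<bar>d\<bar>) * exp (\<bar>t\<bar> * (k + \<bar>m\<bar>))" for z
  proof (cases "z \<in> {- k..k}")
    case True
    have "\<bar>c * z + d\<bar> \<le> \<bar>c\<bar> * \<bar>k\<bar> + \<bar>d\<bar>"
      using True by (intro order_trans[OF abs_triangle_ineq]) (auto simp: abs_mult intro!: mult_left_mono)
    then show ?thesis
      using True trunc_exp_bound[of t "\<bar>t\<bar>" k z m] by (auto simp: abs_mult intro!: mult_mono)
  qed simp
  then show "AE z in \<mu>. norm (indicator {- k..k} z * ((c * z + d) * exp (t * (z - m))))
      \<le> (\<bar>c\<bar> * \<bar>k\<bar> + \<bar>d\<bar>) * exp (\<bar>t\<bar> * (k + \<bar>m\<bar>))"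
    by simp
qed measurable

lemma integrable_trunc_mgf: "integrable \<mu> (\<lambda>z. indicator {- k..k} z * exp (t * (z - m)))"
  using integrable_trunc[of k 0 1 t m] by simp

lemma integrable_trunc_mgf': "integrable \<mu> (\<lambda>z. indicator {- k..k} z * ((z - m) * exp (t * (z - m))))"
  using integrable_trunc[of k 1 "- m" t m] by simp

lemma continuous_on_trunc_mgf': "continuous_on {0..T} (trunc_mgf' k m)"
proof (rule continuous_on_sequentiallyI)
  fix u t assume u: "\<forall>n. u n \<in> {0..T}" and t: "t \<in> {0..T}" and lim: "u \<longlonglongrightarrow> t"
  show "(\<lambda>n. trunc_mgf' k m (u n)) \<longlonglongrightarrow> trunc_mgf' k m t"
    unfolding trunc_mgf'_def
  proof (rule integral_dominated_convergence[where w="\<lambda>_. (\<bar>k\<bar> + \<bar>m\<bar>) * exp (T * (k + \<bar>m\<bar>))"])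
    show "AE z in \<mu>. (\<lambda>n. indicator {- k..k} z * ((z - m) * exp (u n * (z - m))))
        \<longlonglongrightarrow> indicator {- k..k} z * ((z - m) * exp (t * (z - m)))"
      by (auto intro!: tendsto_intros lim)
    have "norm (indicator {- k..k} z * ((z - m) * exp (u n * (z - m))))
        \<le> (\<bar>k\<bar> + \<bar>m\<bar>) * exp (T * (k + \<bar>m\<bar>))" for z n
    proof (cases "z \<in> {- k..k}")
      case True
      then show ?thesis
        using trunc_exp_bound[of "u n" T k z m] u[rule_format, of n]
        by (auto simp: abs_mult intro!: mult_mono)
    qed simp
    then show "AE z in \<mu>. norm (indicator {- k..k} z * ((z - m) * exp (u n * (z - m))))
        \<le> (\<bar>k\<bar> + \<bar>m\<bar>) * exp (T * (k + \<bar>m\<bar>))" for n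
      by simp
  qed auto
qed

text \<open>Intermediate value theorem. At t = 0 symmetry of the truncation leaves -m times its
  mass; for large t the mass on [w, k], to the right of \<open>m\<close>, dominates.\<close>

lemma trunc_mgf'_zero_exists:
  assumes "0 \<le> m" "m < w" and p: "0 < measure \<mu> {w..k}"
  shows "\<exists>t\<ge>0. trunc_mgf' k m t = 0"
proof -
  have "w \<le> k"
    using p by (rule_tac ccontr) simp
  let ?p = "measure \<mu> {w..k}"
  \<comment> \<open>Chosen so that (w - m) * T(w - m) * ?p = k + m. Together with u \<le> exp u, the
    mass on [w, k] then outweighs the worst negative value -(k + m) of the integrand.\<close>
  define T where "T = (k + m) / ((w - m)\<^sup>2 * ?p)"
  have "0 \<le> T"
    using assms \<open>w \<le> k\<close> by (simp add: T_def)
  have int: "integrable \<mu> (\<lambda>z. indicator {- k..k} z * z)" "integrable \<mu> (\<lambda>z. indicator {- k..k} z * m)"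
    using integrable_trunc[of k 1 0 0 0] integrable_trunc[of k 0 m 0 0] by simp_all
  have "(\<integral>z. indicator {- k..k} z * z \<partial>\<mu>) = (\<integral>z. indicator {- k..k} (- z) * (- z) \<partial>\<mu>)"
    by (rule integral_uminus[symmetric]) measurable
  also have "\<dots> = - (\<integral>z. indicator {- k..k} z * z \<partial>\<mu>)"
    unfolding integral_minus[symmetric] by (intro Bochner_Integration.integral_cong) (auto simp: indicator_def)
  finally have "(\<integral>z. indicator {- k..k} z * z \<partial>\<mu>) = 0" by simp
  then have "trunc_mgf' k m 0 = - (\<integral>z. indicator {- k..k} z * m \<partial>\<mu>)"
    unfolding trunc_mgf'_def using int by (simp add: right_diff_distrib)
  also have "\<dots> \<le> 0"
    using \<open>0 \<le> m\<close> by simp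
  finally have F0: "trunc_mgf' k m 0 \<le> 0" .
  have "k + m = (w - m) * (T * (w - m)) * ?p"
  proof -
    have "(w - m) * (T * (w - m)) * ?p = T * ((w - m)\<^sup>2 * ?p)"
      by (simp add: power2_eq_square)
    also have "\<dots> = k + m"
      using assms by (simp add: T_def)
    finally show ?thesis ..
  qed
  also have "\<dots> \<le> (w - m) * exp (T * (w - m)) * ?p"
  proof -
    have "T * (w - m) \<le> exp (T * (w - m))"
      using exp_ge_add_one_self[of "T * (w - m)"] by linarith
    then show ?thesis
      using assms by (intro mult_right_mono mult_left_mono) auto
  qed
  finally have "0 \<le> (w - m) * exp (T * (w - m)) * ?p - (k + m)" by simp
  also have "\<dots> = (\<integral>z. indicator {w..k} z * ((w - m) * exp (T * (w - m))) - (k + m) \<partial>\<mu>)"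
    by (subst Bochner_Integration.integral_diff)
      (auto simp: prob_space[simplified] emeasure_eq_measure intro!: integrable_mult_left integrable_real_indicator)
  also have "\<dots> \<le> trunc_mgf' k m T"
    unfolding trunc_mgf'_def
  proof (intro integral_mono integrable_trunc_mgf')
    show "integrable \<mu> (\<lambda>z. indicator {w..k} z * ((w - m) * exp (T * (w - m))) - (k + m))"
      by (auto simp: emeasure_eq_measure intro!: integrable_mult_left integrable_real_indicator)
    fix z
    \<comment> \<open>The integrand is negative only for z < m inside the window, where the
      exponential factor is at most 1 and z - m is at least -(k + m).\<close>
    consider "z \<in> {w..k}" | "z < m" "z \<in> {- k..k}" | "m \<le> z" "z < w" | "z \<notin> {- k..k}"
      using \<open>w \<le> k\<close> assms by force
    then show "indicator {w..k} z * ((w - m) * exp (T * (w - m))) - (k + m)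
        \<le> indicator {- k..k} z * ((z - m) * exp (T * (z - m)))"
    proof cases
      case 1
      then have "(w - m) * exp (T * (w - m)) \<le> (z - m) * exp (T * (z - m))"
        using assms \<open>0 \<le> T\<close> by (intro mult_mono) (auto intro!: mult_left_mono)
      then show ?thesis
        using 1 assms by (auto simp: indicator_def)
    next
      case 2
      have "(m - z) * exp (T * (z - m)) \<le> (m - z) * 1"
        using 2 \<open>0 \<le> T\<close> by (intro mult_left_mono) (auto simp: mult_le_0_iff)
      then show ?thesis
        using 2 assms by (auto simp: indicator_def algebra_simps)
    next
      case 3
      then have "0 \<le> (z - m) * exp (T * (z - m))" by simp
      then have "- k - m \<le> (z - m) * exp (T * (z - m))"
        using assms \<open>w \<le> k\<close> by linarith
      then show ?thesis
        using 3 assms \<open>w \<le> k\<close> by (auto simp: indicator_def)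
    next
      case 4
      then show ?thesis
        using assms \<open>w \<le> k\<close> by (auto simp: indicator_def)
    qed
  qed
  finally have FT: "0 \<le> trunc_mgf' k m T" .
  show ?thesis
    using IVT'[OF F0 FT \<open>0 \<le> T\<close> continuous_on_trunc_mgf'] by auto
qed

text \<open>A critical point of a convex function is a minimum, and the value at t = 0 is a
  probability. The inequality 1 - u \<le> exp(-u) with u = t(z - m) expresses this directly.\<close>

lemma trunc_mgf_le_1:
  assumes "trunc_mgf' k m t = 0"
  shows "trunc_mgf k m t \<le> 1"
proof -
  have "trunc_mgf k m t = trunc_mgf k m t - t * trunc_mgf' k m t"
    using assms by simp
  also have "\<dots> = (\<integral>z. indicator {- k..k} z * exp (t * (z - m))
      - t * (indicator {- k..k} z * ((z - m) * exp (t * (z - m)))) \<partial>\<mu>)"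
    unfolding trunc_mgf_def trunc_mgf'_def using integrable_trunc_mgf integrable_trunc_mgf' by simp
  also have "\<dots> \<le> (\<integral>z. 1 \<partial>\<mu>)"
  proof (intro integral_mono)
    fix z
    have "(1 - t * (z - m)) * exp (t * (z - m)) \<le> exp (- (t * (z - m))) * exp (t * (z - m))"
      using exp_ge_add_one_self[of "- (t * (z - m))"] by (intro mult_right_mono) auto
    also have "\<dots> = 1"
      by (simp flip: exp_add)
    finally show "indicator {- k..k} z * exp (t * (z - m))
      - t * (indicator {- k..k} z * ((z - m) * exp (t * (z - m)))) \<le> 1"
      by (auto simp: indicator_def algebra_simps)
  qed (auto intro!: integrable_trunc_mgf integrable_trunc_mgf' Bochner_Integration.integrable_diff integrable_mult_right)
  also have "\<dots> = 1"
    using prob_space by simp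
  finally show ?thesis .
qed

text \<open>Keeps only the mass on [w, k]. With \<open>trunc_mgf_le_1\<close> this bounds the
  critical tilts as long as w - m stays away from 0.\<close>

lemma trunc_mgf_ge:
  assumes "0 \<le> t" "- k \<le> w"
  shows "exp (t * (w - m)) * measure \<mu> {w..k} \<le> trunc_mgf k m t"
proof -
  have "exp (t * (w - m)) * measure \<mu> {w..k} = (\<integral>z. exp (t * (w - m)) * indicator {w..k} z \<partial>\<mu>)"
    by simp
  also have "\<dots> \<le> trunc_mgf k m t"
    unfolding trunc_mgf_def
  proof (intro integral_mono integrable_trunc_mgf)
    show "integrable \<mu> (\<lambda>z. exp (t * (w - m)) * indicator {w..k} z)"
      by (auto simp: emeasure_eq_measure intro!: integrable_mult_right integrable_real_indicator)
    show "exp (t * (w - m)) * indicator {w..k} z \<le> indicator {- k..k} z * exp (t * (z - m))" for z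
      using assms by (auto simp: indicator_def intro!: mult_left_mono)
  qed
  finally show ?thesis .
qed

end

section \<open>Near-optimal tilts, uniform over compact intervals\<close>

context even_law
begin

text \<open>Minimality of the tilts bounds them, and Fatou's lemma along a convergent subsequence
  compares the limit of the truncated problems with \<open>Lambda1_star\<close>. Truncation makes every tilt
  available, whatever the domain of \<open>Lambda1\<close>.\<close>

lemma trunc_tilt_near_optimal:
  assumes "0 \<le> y" "ereal y < xstar \<mu>" "Lambda1_star \<mu> y = ereal a" "0 < \<delta>"
  obtains k m t where "0 \<le> k" "y < m" "trunc_mgf' k m t = 0" "0 < trunc_mgf k m t"
    "- ln (trunc_mgf k m t) \<le> a + \<delta>"
proof -
  from assms(2) obtain w where w: "y < w" "0 < measure \<mu> {w..}"
    by (auto simp: xstar_def less_Sup_iff)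
  have "(\<lambda>n. measure \<mu> {w..real n}) \<longlonglongrightarrow> measure \<mu> (\<Union>n. {w..real n})"
    by (rule finite_Lim_measure_incseq) (auto simp: incseq_def)
  also have "(\<Union>n. {w..real n}) = {w..}"
    using real_arch_simple by fastforce
  finally have "eventually (\<lambda>n. 0 < measure \<mu> {w..real n}) sequentially"
    using w(2) by (rule order_tendstoD)
  \<comment> \<open>Starting the truncations at \<open>K\<close> keeps the mass of [w, k n] at least
    \<open>p > 0\<close> for all n.\<close>
  then obtain K where K: "0 < measure \<mu> {w..real K}"
    by (auto simp: eventually_sequentially)
  define p where "p = measure \<mu> {w..real K}"
  have p: "0 < p" using K by (simp add: p_def)
  define k where "k n = real (K + n)" for n
  \<comment> \<open>The targets decrease to \<open>y\<close> but stay strictly above it; the 2 in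
    the denominator keeps them at least half the gap w - y below \<open>w\<close>.\<close>
  define m where "m n = y + (w - y) / (real n + 2)" for n
  have p_le: "p \<le> measure \<mu> {w..k n}" for n
    unfolding p_def k_def by (intro finite_measure_mono) auto
  have m: "y < m n" "(w - y) / 2 \<le> w - m n" "m n < w" for n
  proof -
    have "(w - y) / (real n + 2) \<le> (w - y) / 2"
      using w by (intro divide_left_mono) auto
    moreover have "0 < (w - y) / (real n + 2)"
      using w by simp
    ultimately show "y < m n" "(w - y) / 2 \<le> w - m n" "m n < w"
      using w by (auto simp: m_def field_simps)
  qed
  have "\<exists>t\<ge>0. trunc_mgf' (k n) (m n) t = 0" for n
    using m[of n] p_le[of n] p assms(1) by (intro trunc_mgf'_zero_exists[where w=w]) auto
  then obtain t where t: "\<And>n. 0 \<le> t n" "\<And>n. trunc_mgf' (k n) (m n) (t n) = 0"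
    by metis
  have ge: "exp (t n * (w - m n)) * p \<le> trunc_mgf (k n) (m n) (t n)" for n
  proof -
    have "exp (t n * (w - m n)) * p \<le> exp (t n * (w - m n)) * measure \<mu> {w..k n}"
      by (intro mult_left_mono p_le) simp
    also have "\<dots> \<le> trunc_mgf (k n) (m n) (t n)"
      using t(1) w(1) assms(1) by (intro trunc_mgf_ge) (auto simp: k_def)
    finally show ?thesis .
  qed
  have pos: "0 < trunc_mgf (k n) (m n) (t n)" for n
    using ge[of n] p by (intro less_le_trans[OF _ ge]) auto
  define q where "q = exp (- (a + \<delta>))"
  show thesis
  \<comment> \<open>Either some truncated problem already has entropy at most a + \<delta>, or all
    values are below q; in the second case the limiting slope forces the transform at
    \<open>y\<close> up to a + \<delta>, a contradiction.\<close>
  proof (cases "\<exists>n. q \<le> trunc_mgf (k n) (m n) (t n)")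
    case True
    then obtain n where "q \<le> trunc_mgf (k n) (m n) (t n)" ..
    then have "ln q \<le> ln (trunc_mgf (k n) (m n) (t n))"
      using pos[of n] by (subst ln_le_cancel_iff) (auto simp: q_def)
    then show thesis
      using pos[of n] t[of n] m[of n] by (intro that[of "k n" "m n" "t n"]) (auto simp: k_def q_def)
  next
    case False
    \<comment> \<open>The mass near \<open>w\<close> makes \<open>trunc_mgf\<close> grow like
      exp(t(w - m)), yet at a critical tilt it is at most 1.\<close>
    have t_le: "t n \<le> - ln p / ((w - y) / 2)" for n
    proof -
      have "exp (t n * (w - m n)) * p \<le> 1"
        using ge[of n] trunc_mgf_le_1[OF t(2)[of n]] by linarith
      then have "ln (exp (t n * (w - m n)) * p) \<le> 0"
        using p by (subst ln_le_zero_iff) auto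
      then have "t n * (w - m n) \<le> - ln p"
        using p by (simp add: ln_mult)
      moreover have "t n * ((w - y) / 2) \<le> t n * (w - m n)"
        by (intro mult_left_mono m t)
      ultimately have "t n * ((w - y) / 2) \<le> - ln p" by linarith
      then show ?thesis
        using w by (subst pos_le_divide_eq) auto
    qed
    have "bounded (range t)"
      using t(1) t_le by (intro bounded_subset[OF bounded_closed_interval[of 0 "- ln p / ((w - y) / 2)"]]) auto
    then obtain l \<phi> where \<phi>: "strict_mono \<phi>" "(t \<circ> \<phi>) \<longlonglongrightarrow> l"
      using bounded_imp_convergent_subsequence by blast
    have "m \<longlonglongrightarrow> y"
      unfolding m_def by real_asymp
    then have lim_m: "(m \<circ> \<phi>) \<longlonglongrightarrow> y"
      using \<phi>(1) by (rule LIMSEQ_subseq_LIMSEQ)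
    define u where "u n z = ennreal (indicator {- k (\<phi> n)..k (\<phi> n)} z * exp (t (\<phi> n) * (z - m (\<phi> n))))" for n z
    have u: "(\<lambda>n. u n z) \<longlonglongrightarrow> ennreal (exp (l * (z - y)))" for z
    proof -
      obtain n0 :: nat where n0: "\<bar>z\<bar> \<le> real n0"
        using real_arch_simple by blast
      have "eventually (\<lambda>n. ennreal (exp ((t \<circ> \<phi>) n * (z - (m \<circ> \<phi>) n))) = u n z) sequentially"
        using eventually_ge_at_top[of n0]
      proof eventually_elim
        case (elim n)
        with seq_suble[OF \<phi>(1), of n] n0 have "\<bar>z\<bar> \<le> k (\<phi> n)"
          by (simp add: k_def)
        then show ?case by (simp add: u_def indicator_def abs_le_iff)
      qed
      moreover have "(\<lambda>n. ennreal (exp ((t \<circ> \<phi>) n * (z - (m \<circ> \<phi>) n)))) \<longlonglongrightarrow> ennreal (exp (l * (z - y)))"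
        by (intro tendsto_intros \<phi> lim_m)
      ultimately show ?thesis
        by (rule Lim_transform_eventually[rotated])
    qed
    have "(\<integral>\<^sup>+z. ennreal (exp (l * (z - y))) \<partial>\<mu>) = (\<integral>\<^sup>+z. liminf (\<lambda>n. u n z) \<partial>\<mu>)"
      using u by (intro nn_integral_cong) (auto intro!: lim_imp_Liminf[symmetric])
    also have "\<dots> \<le> liminf (\<lambda>n. \<integral>\<^sup>+z. u n z \<partial>\<mu>)"
      by (rule nn_integral_liminf) (auto simp: u_def)
    also have "\<dots> \<le> limsup (\<lambda>n. \<integral>\<^sup>+z. u n z \<partial>\<mu>)"
      by (intro Liminf_le_Limsup) simp
    also have "\<dots> \<le> ennreal q"
    proof (intro Limsup_bounded always_eventually allI)
      fix n
      have "(\<integral>\<^sup>+z. u n z \<partial>\<mu>) = ennreal (trunc_mgf (k (\<phi> n)) (m (\<phi> n)) (t (\<phi> n)))"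
        unfolding u_def trunc_mgf_def by (rule nn_integral_eq_integral[OF integrable_trunc_mgf]) simp
      also have "\<dots> \<le> ennreal q"
        using False by (intro ennreal_leI) (auto simp: not_le less_imp_le)
      finally show "(\<integral>\<^sup>+z. u n z \<partial>\<mu>) \<le> ennreal q" .
    qed
    finally have "ereal (- ln q) \<le> Lambda1_star \<mu> y"
      by (intro Lambda1_star_ge[OF prob_space_axioms sets_\<mu>]) (auto simp: q_def)
    with assms(3,4) show thesis by (simp add: q_def)
  qed
qed

text \<open>At a critical tilt z - m has mean 0, so the log-density t(z - m) - ln J has mean -ln J,
  and \<open>z - x\<close> has mean m - x. The window makes both bounded.\<close>

lemma tilted_trunc:
  assumes "0 \<le> k" "trunc_mgf' k m t = 0" and J: "0 < trunc_mgf k m t"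
    and x: "\<bar>x\<bar> + k \<le> \<kappa>" "\<theta> * \<kappa> \<le> m - x"
  shows "tilted \<mu> \<theta> (\<bar>t\<bar> * (k + \<bar>m\<bar>)) 1 x (- ln (trunc_mgf k m t))"
proof -
  define J where "J = trunc_mgf k m t"
  define f where "f z = indicator {- k..k} z * exp (t * (z - m)) / J" for z
  \<comment> \<open>Outside the window the density is 0, and the value \<open>- ln J\<close> there
    keeps \<open>h\<close> within the required distance of its mean.\<close>
  define h where "h z = indicator {- k..k} z * (t * (z - m)) - ln J" for z
  define g where "g z = indicator {- k..k} z * (z - x)" for z
  have "0 < J" using J by (simp add: J_def)
  have int0: "(\<integral>z. indicator {- k..k} z * exp (t * (z - m)) / J \<partial>\<mu>) = 1"
    using \<open>0 < J\<close> by (simp add: J_def trunc_mgf_def)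
  have int_affine: "(\<integral>z. indicator {- k..k} z * exp (t * (z - m)) / J * (c * (z - m) + d) \<partial>\<mu>) = d" for c d
  proof -
    have "(\<integral>z. indicator {- k..k} z * exp (t * (z - m)) / J * (c * (z - m) + d) \<partial>\<mu>)
      = (\<integral>z. (c / J) * (indicator {- k..k} z * ((z - m) * exp (t * (z - m))))
          + (d / J) * (indicator {- k..k} z * exp (t * (z - m))) \<partial>\<mu>)"
      by (intro Bochner_Integration.integral_cong refl) (simp add: algebra_simps add_divide_distrib diff_divide_distrib)
    also have "\<dots> = (c / J) * trunc_mgf' k m t + (d / J) * trunc_mgf k m t"
      unfolding trunc_mgf_def trunc_mgf'_def
      by (subst Bochner_Integration.integral_add)
        (auto intro!: integrable_trunc_mgf integrable_trunc_mgf' integrable_mult_right)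
    also have "\<dots> = d"
      using assms(2) \<open>0 < J\<close> by (simp add: J_def)
    finally show ?thesis .
  qed
  show ?thesis
    unfolding tilted_def J_def[symmetric]
  proof (intro exI conjI allI)
    show "f \<in> borel_measurable borel" "h \<in> borel_measurable borel" "g \<in> borel_measurable borel"
      unfolding f_def h_def g_def by measurable
    show "0 \<le> f z" for z
      using \<open>0 < J\<close> by (simp add: f_def)
    show "f z \<le> exp (h z)" for z
      using \<open>0 < J\<close> by (simp add: f_def h_def indicator_def exp_diff)
    show "\<bar>h z - - ln J\<bar> \<le> \<bar>t\<bar> * (k + \<bar>m\<bar>)" for z
      using \<open>0 \<le> k\<close> by (auto simp: h_def indicator_def abs_mult intro!: mult_left_mono)
    show "\<bar>g z\<bar> \<le> \<kappa>" for z
      using \<open>0 \<le> k\<close> x(1) by (auto simp: g_def indicator_def)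
    show "f z \<noteq> 0 \<longrightarrow> g z \<le> 1 * z - x" for z
      by (auto simp: f_def g_def indicator_def)
    have "(\<integral>\<^sup>+z. ennreal (f z) \<partial>\<mu>) = ennreal (\<integral>z. f z \<partial>\<mu>)"
      unfolding f_def using integrable_trunc_mgf \<open>0 < J\<close>
      by (intro nn_integral_eq_integral) (auto intro!: integrable_divide)
    then show "(\<integral>\<^sup>+z. ennreal (f z) \<partial>\<mu>) = 1"
      using int0 by (simp only: f_def ennreal_1)
    have "(\<integral>z. f z * h z \<partial>\<mu>) = (\<integral>z. indicator {- k..k} z * exp (t * (z - m)) / J * (t * (z - m) + (- ln J)) \<partial>\<mu>)"
      by (intro Bochner_Integration.integral_cong refl) (auto simp: f_def h_def indicator_def)
    then show "(\<integral>z. f z * h z \<partial>\<mu>) = - ln J"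
      unfolding int_affine .
    have "(\<integral>z. f z * g z \<partial>\<mu>) = (\<integral>z. indicator {- k..k} z * exp (t * (z - m)) / J * (1 * (z - m) + (m - x)) \<partial>\<mu>)"
      by (intro Bochner_Integration.integral_cong refl) (auto simp: f_def g_def indicator_def)
    then show "\<theta> * \<kappa> \<le> (\<integral>z. f z * g z \<partial>\<mu>)"
      unfolding int_affine using x(2) by simp
  qed
qed

text \<open>Markov's inequality bounds the transform by -ln of the tail. It needs a nonnegative
  slope; evenness allows \<bar>t\<bar> in place of t, and this does not lower tx since x \<ge>
  0.\<close>

lemma Lambda1_star_finite:
  assumes "0 \<le> x" "0 < measure \<mu> {x..}"
  shows "Lambda1_star \<mu> x \<noteq> \<infinity>"
proof
  let ?p = "measure \<mu> {x..}"
  assume "Lambda1_star \<mu> x = \<infinity>"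
  then have "ereal (- ln ?p) < Lambda1_star \<mu> x" by simp
  then obtain t l where tl: "Lambda1 \<mu> t = ereal l" "- ln ?p < t * x - l"
    by (rule less_Lambda1_starE)
  have "- ln ?p < \<bar>t\<bar> * x - l"
    using tl(2) mult_right_mono[OF abs_ge_self[of t] assms(1)] by linarith
  have "Lambda1 \<mu> \<bar>t\<bar> = ereal l"
    using tl(1) Lambda1_uminus[of t] by (auto simp: abs_if)
  then have I: "(\<integral>\<^sup>+z. ennreal (exp (\<bar>t\<bar> * z)) \<partial>\<mu>) = ennreal (exp l)"
    unfolding Lambda1_def using prob_space_axioms by (subst (asm) log_mgf_eq_ereal_iff) auto
  have "ennreal (exp (\<bar>t\<bar> * x) * ?p) = (\<integral>\<^sup>+z. ennreal (exp (\<bar>t\<bar> * x)) * indicator {x..} z \<partial>\<mu>)"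
    by (simp add: nn_integral_cmult_indicator emeasure_eq_measure ennreal_mult)
  also have "\<dots> \<le> (\<integral>\<^sup>+z. ennreal (exp (\<bar>t\<bar> * z)) \<partial>\<mu>)"
    by (intro nn_integral_mono) (auto simp: indicator_def intro!: ennreal_leI mult_left_mono)
  finally have "exp (\<bar>t\<bar> * x) * ?p \<le> exp l"
    by (simp add: I)
  then have "ln (exp (\<bar>t\<bar> * x) * ?p) \<le> ln (exp l)"
    using assms(2) by (subst ln_le_cancel_iff) auto
  then show False
    using assms(2) \<open>- ln ?p < \<bar>t\<bar> * x - l\<close> by (simp add: ln_mult)
qed

text \<open>One tilt serves a whole neighbourhood: its mean \<open>m\<close> is strictly above
  \<open>y\<close>, which leaves room to move \<open>x\<close>, and an affine minorant nearly
  optimal at \<open>y\<close> prevents the transform from dropping much nearby.\<close>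

lemma tilted_near_point:
  assumes "0 \<le> y" "ereal y < xstar \<mu>" "0 < \<delta>"
  obtains U \<theta> B where "open U" "y \<in> U" "0 < \<theta>"
    "\<And>x a. x \<in> U \<Longrightarrow> Lambda1_star \<mu> x = ereal a \<Longrightarrow> \<exists>H\<le>a + \<delta>. tilted \<mu> \<theta> B 1 x H"
proof -
  obtain b where b: "Lambda1_star \<mu> y = ereal b"
    using Lambda1_star_finite[OF assms(1) measure_pos_if_less_xstar[OF assms(2)]]
      Lambda1_star_nonneg[OF prob_space_axioms, of y] by (cases "Lambda1_star \<mu> y") auto
  obtain k m t where kmt: "0 \<le> k" "y < m" "trunc_mgf' k m t = 0" "0 < trunc_mgf k m t"
      "- ln (trunc_mgf k m t) \<le> b + \<delta> / 2"
    using trunc_tilt_near_optimal[OF assms(1,2) b, of "\<delta> / 2"] assms(3) by auto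
  have "ereal (b - \<delta> / 2) < Lambda1_star \<mu> y"
    using assms(3) by (simp add: b)
  then obtain r l where r: "Lambda1 \<mu> r = ereal l" "b - \<delta> / 2 < r * y - l"
    by (rule less_Lambda1_starE)
  \<comment> \<open>The three conditions control the affine minorant, leave the gap m - x at least
    (m - y)/2, and bound \<bar>x\<bar>. Then \<kappa> bounds \<bar>x\<bar> + k, and \<theta> is the
    guaranteed gap divided by \<kappa>.\<close>
  define U where "U = {x. b - \<delta> / 2 < r * x - l} \<inter> {x. x < (y + m) / 2} \<inter> {y - 1<..}"
  define \<kappa> where "\<kappa> = y + 1 + m + k"
  define \<theta> where "\<theta> = (m - y) / 2 / \<kappa>"
  have "0 < \<kappa>"
    using assms(1) kmt by (simp add: \<kappa>_def)
  show thesis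
  proof (rule that[of U \<theta> "\<bar>t\<bar> * (k + \<bar>m\<bar>)"])
    show "open U"
      unfolding U_def by (intro open_Int open_Collect_less continuous_intros) auto
    show "y \<in> U"
      using r kmt by (auto simp: U_def)
    show "0 < \<theta>"
      using kmt \<open>0 < \<kappa>\<close> by (simp add: \<theta>_def)
    fix x a assume x: "x \<in> U" and a: "Lambda1_star \<mu> x = ereal a"
    have "ereal (r * x - l) \<le> Lambda1_star \<mu> x"
      by (rule Lambda1_star_ge_affine) fact
    then have "b \<le> a + \<delta> / 2"
      using x by (auto simp: a U_def)
    moreover have "tilted \<mu> \<theta> (\<bar>t\<bar> * (k + \<bar>m\<bar>)) 1 x (- ln (trunc_mgf k m t))"
    proof (rule tilted_trunc[where \<kappa>=\<kappa>])
      have "y - 1 < x" "x < (y + m) / 2"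
        using x by (auto simp: U_def)
      moreover from this have "x \<le> y + 1 + m" "- x \<le> y + 1 + m"
        using kmt(2) assms(1) by (simp_all add: field_simps)
      ultimately show "\<bar>x\<bar> + k \<le> \<kappa>"
        by (simp add: \<kappa>_def abs_le_iff)
      have "\<theta> * \<kappa> = (m - y) / 2"
        using \<open>0 < \<kappa>\<close> by (simp add: \<theta>_def)
      then show "\<theta> * \<kappa> \<le> m - x"
        using \<open>x < (y + m) / 2\<close> by (simp add: field_simps)
    qed (use kmt in auto)
    ultimately show "\<exists>H\<le>a + \<delta>. tilted \<mu> \<theta> (\<bar>t\<bar> * (k + \<bar>m\<bar>)) 1 x H"
      using kmt(5) by (intro exI[of _ "- ln (trunc_mgf k m t)"]) auto
  qed
qed

lemma tilted_uniform:
  assumes "ereal M < xstar \<mu>" "0 < \<delta>"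
  obtains \<theta> B where "0 < \<theta>" "\<theta> \<le> 1" "0 < B"
    "\<And>x a. 0 \<le> x \<Longrightarrow> x \<le> M \<Longrightarrow> Lambda1_star \<mu> x = ereal a \<Longrightarrow> \<exists>H\<le>a + \<delta>. tilted \<mu> \<theta> B 1 x H"
proof -
  have "\<exists>U \<theta> B. open U \<and> y \<in> U \<and> 0 < \<theta> \<and>
      (\<forall>x a. x \<in> U \<longrightarrow> Lambda1_star \<mu> x = ereal a \<longrightarrow> (\<exists>H\<le>a + \<delta>. tilted \<mu> \<theta> B 1 x H))"
    if "y \<in> {0..M}" for y
  proof -
    have "ereal y < xstar \<mu>"
      using that assms(1) le_less_trans[of "ereal y" "ereal M"] by auto
    moreover have "0 \<le> y"
      using that by simp
    ultimately obtain U \<theta> B where "open U" "y \<in> U" "0 < \<theta>"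
        "\<And>x a. x \<in> U \<Longrightarrow> Lambda1_star \<mu> x = ereal a \<Longrightarrow> \<exists>H\<le>a + \<delta>. tilted \<mu> \<theta> B 1 x H"
      using tilted_near_point[OF _ _ assms(2)] by metis
    then show ?thesis by blast
  qed
  then obtain U \<theta> B where U: "\<And>y. y \<in> {0..M} \<Longrightarrow> open (U y)" "\<And>y. y \<in> {0..M} \<Longrightarrow> y \<in> U y"
      "\<And>y. y \<in> {0..M} \<Longrightarrow> 0 < \<theta> y"
      "\<And>y x a. y \<in> {0..M} \<Longrightarrow> x \<in> U y \<Longrightarrow> Lambda1_star \<mu> x = ereal a \<Longrightarrow> \<exists>H\<le>a + \<delta>. tilted \<mu> (\<theta> y) (B y) 1 x H"
    by metis
  obtain C where C: "C \<subseteq> {0..M}" "finite C" "{0..M} \<subseteq> (\<Union>y\<in>C. U y)"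
    using U(1,2) by (rule_tac compactE_image[of "{0..M}" "{0..M}" U]) auto
  \<comment> \<open>Inserting 1 keeps \<open>Min\<close> and \<open>Max\<close> meaningful when
    \<open>C\<close> is empty (M < 0), and gives \<theta>' \<le> 1 and B' > 0.\<close>
  define \<theta>' where "\<theta>' = Min (insert 1 (\<theta> ` C))"
  define B' where "B' = Max (insert 1 (B ` C))"
  show thesis
  proof (rule that[of \<theta>' B'])
    show "0 < \<theta>'"
      unfolding \<theta>'_def using C U(3) by (subst Min_gr_iff) auto
    show "\<theta>' \<le> 1" 
      unfolding \<theta>'_def using C by (intro Min_le) auto
    have "1 \<le> B'"
      unfolding B'_def using C by (intro Max_ge) auto
    then show "0 < B'" by simp
    fix x a assume x: "0 \<le> x" "x \<le> M" and a: "Lambda1_star \<mu> x = ereal a"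
    then obtain y where y: "y \<in> C" "x \<in> U y"
      using C(3) by force
    then have "y \<in> {0..M}"
      using C(1) by blast
    then obtain H where H: "H \<le> a + \<delta>" "tilted \<mu> (\<theta> y) (B y) 1 x H"
      using U(4)[OF _ y(2) a] by blast
    have "\<theta>' \<le> \<theta> y" "B y \<le> B'"
      unfolding \<theta>'_def B'_def using y C by (auto intro: Min_le Max_ge)
    with H show "\<exists>H\<le>a + \<delta>. tilted \<mu> \<theta>' B' 1 x H"
      using tilted_mono by blast
  qed
qed

end

section \<open>Half-space depth\<close>

lemma (in even_law) tail_bound_near_xstar:
  assumes "Lambda_star_condition \<mu>" "0 < \<epsilon>"
  obtains M where "ereal M < xstar \<mu>"
    "\<And>x a. M < x \<Longrightarrow> ereal x < xstar \<mu> \<Longrightarrow> Lambda1_star \<mu> x = ereal a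
      \<Longrightarrow> - ln (measure \<mu> {x..}) \<le> (1 + \<epsilon>) * a"
proof -
  define v where "v x = - ln (measure \<mu> {x..}) / real_of_ereal (Lambda1_star \<mu> x)" for x
  define F where "F = (if xstar \<mu> = \<infinity> then at_top else at_left (real_of_ereal (xstar \<mu>)))"
  have "(v \<longlongrightarrow> 1) F"
    using assms(1) by (simp add: Lambda_star_condition_def v_def[abs_def] F_def)
  then have "eventually (\<lambda>x. 0 < v x) F" "eventually (\<lambda>x. v x < 1 + \<epsilon>) F"
    using assms(2) by (auto intro: order_tendstoD)
  then have ev: "eventually (\<lambda>x. 0 < v x \<and> v x < 1 + \<epsilon>) F"
    by (rule eventually_conj)
  have "\<exists>M. ereal M < xstar \<mu> \<and> (\<forall>x. M < x \<longrightarrow> ereal x < xstar \<mu> \<longrightarrow> 0 < v x \<and> v x < 1 + \<epsilon>)"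
  proof (cases "xstar \<mu>")
    case (real b)
    with ev have "eventually (\<lambda>x. 0 < v x \<and> v x < 1 + \<epsilon>) (at_left b)"
      by (simp add: F_def)
    then show ?thesis
      unfolding eventually_at_left_field real by auto
  next
    case PInf
    with ev have "eventually (\<lambda>x. 0 < v x \<and> v x < 1 + \<epsilon>) at_top"
      by (simp add: F_def)
    then obtain M where "\<forall>x\<ge>M. 0 < v x \<and> v x < 1 + \<epsilon>"
      unfolding eventually_at_top_linorder ..
    with PInf show ?thesis
      by (intro exI[of _ M]) auto
  next
    case MInf
    with xstar_nonneg show ?thesis by simp
  qed
  then obtain M where M: "ereal M < xstar \<mu>"
      "\<And>x. M < x \<Longrightarrow> ereal x < xstar \<mu> \<Longrightarrow> 0 < v x \<and> v x < 1 + \<epsilon>"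
    by blast
  show thesis
  proof (rule that[OF M(1)])
    fix x a assume x: "M < x" "ereal x < xstar \<mu>" and a: "Lambda1_star \<mu> x = ereal a"
    have "0 \<le> a"
      using Lambda1_star_nonneg[OF prob_space_axioms, of x] by (simp add: a)
    \<comment> \<open>Division by 0 yields 0, so positivity of the ratio excludes a = 0 and the
      ratio can be multiplied out.\<close>
    moreover have "a \<noteq> 0"
      using M(2)[OF x] by (auto simp: v_def a)
    ultimately have "0 < a" by simp
    then show "- ln (measure \<mu> {x..}) \<le> (1 + \<epsilon>) * a"
      using M(2)[OF x] by (simp add: v_def a field_simps)
  qed
qed

text \<open>Up to \<open>M\<close> the compactness tilts apply, with
  \<open>\<epsilon> * a \<ge> 0\<close> as spare room. Beyond \<open>M\<close>, finiteness of the
  transform places \<bar>x\<bar> left of \<open>xstar \<mu>\<close>, so conditioning on the tail is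
  possible. Reflection handles the sign -1.\<close>

lemma (in even_law) tilted_all:
  assumes atom: "xstar \<mu> < \<infinity> \<Longrightarrow> measure \<mu> {real_of_ereal (xstar \<mu>)} = 0"
    and "Lambda_star_condition \<mu>" "0 < \<epsilon>" "0 < \<delta>"
  obtains \<theta> B where "0 < \<theta>" "\<theta> \<le> 1" "0 < B"
    "\<And>s x a. s \<in> {1, - 1} \<Longrightarrow> Lambda1_star \<mu> x = ereal a \<Longrightarrow> \<exists>H\<le>(1 + \<epsilon>) * a + \<delta>. tilted \<mu> \<theta> B s \<bar>x\<bar> H"
proof -
  obtain M where M: "ereal M < xstar \<mu>"
    "\<And>x a. M < x \<Longrightarrow> ereal x < xstar \<mu> \<Longrightarrow> Lambda1_star \<mu> x = ereal a
      \<Longrightarrow> - ln (measure \<mu> {x..}) \<le> (1 + \<epsilon>) * a"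
    using tail_bound_near_xstar[OF assms(2,3)] by metis
  obtain \<theta> B where \<theta>B: "0 < \<theta>" "\<theta> \<le> 1" "0 < B"
    "\<And>x a. 0 \<le> x \<Longrightarrow> x \<le> M \<Longrightarrow> Lambda1_star \<mu> x = ereal a \<Longrightarrow> \<exists>H\<le>a + \<delta>. tilted \<mu> \<theta> B 1 x H"
    using tilted_uniform[OF M(1) \<open>0 < \<delta>\<close>] by metis
  show thesis
  proof (rule that[OF \<theta>B(1-3)])
    fix s x a :: real assume s: "s \<in> {1, - 1}" and "Lambda1_star \<mu> x = ereal a"
    then have a: "Lambda1_star \<mu> \<bar>x\<bar> = ereal a"
      by (simp add: Lambda1_star_abs)
    then have "0 \<le> a"
      using Lambda1_star_nonneg[OF prob_space_axioms, of "\<bar>x\<bar>"] by simp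
    have "\<exists>H\<le>(1 + \<epsilon>) * a + \<delta>. tilted \<mu> \<theta> B 1 \<bar>x\<bar> H"
    proof (cases "\<bar>x\<bar> \<le> M")
      case True
      then obtain H where "H \<le> a + \<delta>" "tilted \<mu> \<theta> B 1 \<bar>x\<bar> H"
        using \<theta>B(4)[OF _ _ a] by auto
      moreover have "0 \<le> \<epsilon> * a"
        using \<open>0 \<le> a\<close> \<open>0 < \<epsilon>\<close> by simp
      ultimately show ?thesis
        by (intro exI[of _ H]) (auto simp: algebra_simps)
    next
      case False
      have less: "ereal \<bar>x\<bar> < xstar \<mu>"
        using a atom by (intro less_xstar_if_Lambda1_star_finite) auto
      then have "- ln (measure \<mu> {\<bar>x\<bar>..}) \<le> (1 + \<epsilon>) * a"
        using False a by (intro M(2)) auto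
      then show ?thesis
        using tilted_conditioning[OF measure_pos_if_less_xstar[OF less], of B \<theta>] \<theta>B(3) \<open>0 < \<delta>\<close>
        by (intro exI[of _ "- ln (measure \<mu> {\<bar>x\<bar>..})"]) auto
    qed
    then show "\<exists>H\<le>(1 + \<epsilon>) * a + \<delta>. tilted \<mu> \<theta> B s \<bar>x\<bar> H"
      using s tilted_mirror by blast
  qed
qed

text \<open>Choice extracts from \<open>tilted\<close> the functions that
  \<open>halfspace_measure_ge_tilt\<close> takes as parameters.\<close>

lemma halfspace_measure_ge:
  fixes \<mu> :: "real measure" and H c s x :: "nat \<Rightarrow> real" and \<theta> B \<delta> :: real and n :: nat
  assumes \<mu>: "prob_space \<mu>" "sets \<mu> = sets borel"
    and tilt: "\<And>i. i < n \<Longrightarrow> tilted \<mu> \<theta> B (s i) (x i) (H i)"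
    and c: "\<And>i. 0 \<le> c i" and params: "\<theta> \<le> 1" "0 < B" "0 < \<delta>" "1 \<le> n"
  shows "exp (- (\<Sum>i<n. H i) - \<delta> * n) * (\<theta> - exp (- (\<delta>\<^sup>2 * n / (2 * B\<^sup>2))))
    \<le> measure (Pi\<^sub>M {..<n} (\<lambda>_. \<mu>))
        {z \<in> space (Pi\<^sub>M {..<n} (\<lambda>_. \<mu>)). (\<Sum>i<n. c i * x i) \<le> (\<Sum>i<n. c i * (s i * z i))}"
proof -
  \<comment> \<open>The product of measures needs a law at every index, also beyond \<open>n\<close>.\<close>
  define j where "j i = (if i < n then i else 0)" for i
  have "\<forall>i. tilted \<mu> \<theta> B (s (j i)) (x (j i)) (H (j i))"
    using tilt \<open>1 \<le> n\<close> by (simp add: j_def)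
  then have "\<exists>f h g \<kappa>. \<forall>i.
     f i \<in> borel_measurable borel \<and> h i \<in> borel_measurable borel \<and> g i \<in> borel_measurable borel \<and>
     (\<forall>z. 0 \<le> f i z \<and> f i z \<le> exp (h i z) \<and> \<bar>h i z - H (j i)\<bar> \<le> B \<and> \<bar>g i z\<bar> \<le> \<kappa> i \<and>
        (f i z \<noteq> 0 \<longrightarrow> g i z \<le> s (j i) * z - x (j i))) \<and>
     (\<integral>\<^sup>+z. ennreal (f i z) \<partial>\<mu>) = 1 \<and> (\<integral>z. f i z * h i z \<partial>\<mu>) = H (j i) \<and>
     \<theta> * \<kappa> i \<le> (\<integral>z. f i z * g i z \<partial>\<mu>)"
    unfolding tilted_def choice_iff .
  then obtain f h g \<kappa> where *: "\<And>i. f i \<in> borel_measurable borel" "\<And>i. h i \<in> borel_measurable borel"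
     "\<And>i. g i \<in> borel_measurable borel"
     "\<And>i. \<forall>z. 0 \<le> f i z \<and> f i z \<le> exp (h i z) \<and> \<bar>h i z - H (j i)\<bar> \<le> B \<and> \<bar>g i z\<bar> \<le> \<kappa> i \<and>
        (f i z \<noteq> 0 \<longrightarrow> g i z \<le> s (j i) * z - x (j i))"
     "\<And>i. (\<integral>\<^sup>+z. ennreal (f i z) \<partial>\<mu>) = 1" "\<And>i. (\<integral>z. f i z * h i z \<partial>\<mu>) = H (j i)"
     "\<And>i. \<theta> * \<kappa> i \<le> (\<integral>z. f i z * g i z \<partial>\<mu>)"
    by blast
  have "exp (- (\<Sum>i<n. H (j i)) - \<delta> * n) * (\<theta> - exp (- (\<delta>\<^sup>2 * n / (2 * B\<^sup>2))))
    \<le> measure (Pi\<^sub>M {..<n} (\<lambda>_. \<mu>))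
        {z \<in> space (Pi\<^sub>M {..<n} (\<lambda>_. \<mu>)). (\<Sum>i<n. c i * x (j i)) \<le> (\<Sum>i<n. c i * (s (j i) * z i))}"
    by (rule halfspace_measure_ge_tilt[OF \<mu>, where f=f and h=h and g=g and \<kappa>=\<kappa>
        and H="\<lambda>i. H (j i)" and s="\<lambda>i. s (j i)" and x="\<lambda>i. x (j i)"]) (use * c params in auto)
  moreover have "j i = i" if "i < n" for i
    using that by (simp add: j_def)
  ultimately show ?thesis
    by (simp cong: sum.cong_simp)
qed

theorem theorem3p3:
  fixes \<mu> :: "real measure"
  assumes "prob_space \<mu>"
    and "sets \<mu> = sets borel"
    and "admissible \<mu>"
    and "even_measure \<mu>"
    and "Lambda_star_condition \<mu>"
  shows "\<forall>\<epsilon>>0. \<exists>n0::nat. \<forall>n\<ge>n0. n \<ge> 1 \<longrightarrow> (\<forall>r>0. \<forall>x \<in> B_r n \<mu> r.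
           tukey_depth n \<mu> x \<ge> exp (- (1 + \<epsilon>) * r - 2 * \<epsilon> * real n))"
proof (intro allI impI)
  fix \<epsilon> :: real assume "0 < \<epsilon>"
  interpret even_law \<mu>
    using assms by (simp add: even_law_def even_law_axioms_def)
  \<comment> \<open>The allowance 2\<epsilon>n equals 4\<delta>n. Three shares are spent: on the
    entropies of the tilts, on the fluctuation of the log-density, and on the factor left over from
    \<theta>.\<close>
  define \<delta> where "\<delta> = \<epsilon> / 2"
  have "0 < \<delta>" using \<open>0 < \<epsilon>\<close> by (simp add: \<delta>_def)
  obtain \<theta> B where \<theta>B: "0 < \<theta>" "\<theta> \<le> 1" "0 < B"
    "\<And>s x a. s \<in> {1, - 1} \<Longrightarrow> Lambda1_star \<mu> x = ereal a \<Longrightarrow> \<exists>H\<le>(1 + \<epsilon>) * a + \<delta>. tilted \<mu> \<theta> B s \<bar>x\<bar> H"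
    using assms(3) tilted_all[OF _ assms(5) \<open>0 < \<epsilon>\<close> \<open>0 < \<delta>\<close>] by (auto simp: admissible_def)
  have lim: "(\<lambda>n. exp (- (C * real n))) \<longlonglongrightarrow> 0" if "0 < C" for C
    using that by real_asymp
  \<comment> \<open>For large n the Hoeffding error leaves at least exp(-\<delta>n) of \<theta>. The
    threshold comes from \<theta>, B and \<delta> alone, so it is fixed before r and x.\<close>
  have "(\<lambda>n. exp (- (\<delta>\<^sup>2 / (2 * B\<^sup>2) * real n)) + exp (- (\<delta> * real n))) \<longlonglongrightarrow> 0 + 0"
    using \<open>0 < \<delta>\<close> \<open>0 < B\<close> by (intro tendsto_add lim) auto
  then have "eventually (\<lambda>n. exp (- (\<delta>\<^sup>2 / (2 * B\<^sup>2) * real n)) + exp (- (\<delta> * real n)) < \<theta>) sequentially"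
    using \<open>0 < \<theta>\<close> by (intro order_tendstoD(2)) auto
  then obtain n0 where n0: "\<And>n. n0 \<le> n \<Longrightarrow> exp (- (\<delta>\<^sup>2 / (2 * B\<^sup>2) * real n)) + exp (- (\<delta> * real n)) < \<theta>"
    by (auto simp: eventually_sequentially)
  have "exp (- (1 + \<epsilon>) * r - 2 * \<epsilon> * real n) \<le> tukey_depth n \<mu> x"
    if n: "n0 \<le> n" "1 \<le> n" and "0 < r" and x: "x \<in> B_r n \<mu> r" for n r x
    unfolding tukey_depth_def
  proof (rule cInf_greatest)
    \<comment> \<open>\<open>Inf\<close> of an empty set would carry no information, so some
      half-space containing \<open>x\<close> is exhibited; its normal is nonzero at index 0 because
      n \<ge> 1.\<close>
    have "{z \<in> {..<n} \<rightarrow>\<^sub>E UNIV. inner_n n (\<lambda>_. 1) z \<ge> inner_n n (\<lambda>_. 1) x} \<in> halfspaces n"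
      using n unfolding halfspaces_def
      by (intro CollectI exI[of _ "\<lambda>_. 1"] exI[of _ "inner_n n (\<lambda>_. 1) x"]) (auto intro!: exI[of _ 0])
    moreover have "x \<in> {z \<in> {..<n} \<rightarrow>\<^sub>E UNIV. inner_n n (\<lambda>_. 1) z \<ge> inner_n n (\<lambda>_. 1) x}"
      using x by (simp add: B_r_def)
    ultimately show "{measure (mu_n n \<mu>) H |H. H \<in> halfspaces n \<and> x \<in> H} \<noteq> {}"
      by blast
  next
    fix y assume "y \<in> {measure (mu_n n \<mu>) H |H. H \<in> halfspaces n \<and> x \<in> H}"
    then obtain \<xi> b where y: "y = measure (mu_n n \<mu>) {z \<in> {..<n} \<rightarrow>\<^sub>E UNIV. inner_n n \<xi> z \<ge> b}"
        and b: "b \<le> inner_n n \<xi> x"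
      by (auto simp: halfspaces_def)
    obtain a where a: "\<And>i. i < n \<Longrightarrow> Lambda1_star \<mu> (x i) = ereal (a i)" "(\<Sum>i<n. a i) \<le> r"
      using B_r_Lambda1_star[OF assms(1,2) x] by metis
    \<comment> \<open>With these signs \<langle>\<xi>, z\<rangle> is the sum of \<bar>\<xi> i\<bar>
      * (s i * z i), with nonnegative weights, while \<langle>\<xi>, x\<rangle> is at most the sum
      of \<bar>\<xi> i\<bar> * \<bar>x i\<bar>. Aiming at \<bar>x i\<bar> thus covers every
      half-space containing \<open>x\<close>.\<close>
    define s where "s i = (if 0 \<le> \<xi> i then 1 else - 1 :: real)" for i
    have "\<exists>H\<le>(1 + \<epsilon>) * a i + \<delta>. tilted \<mu> \<theta> B (s i) \<bar>x i\<bar> H" if "i < n" for i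
      using a(1)[OF that] by (intro \<theta>B(4)) (auto simp: s_def)
    then obtain H where H: "\<And>i. i < n \<Longrightarrow> H i \<le> (1 + \<epsilon>) * a i + \<delta>"
        "\<And>i. i < n \<Longrightarrow> tilted \<mu> \<theta> B (s i) \<bar>x i\<bar> (H i)"
      by metis
    have "(\<Sum>i<n. H i) \<le> (\<Sum>i<n. (1 + \<epsilon>) * a i + \<delta>)"
      using H(1) by (intro sum_mono) auto
    also have "\<dots> = (1 + \<epsilon>) * (\<Sum>i<n. a i) + \<delta> * n"
      by (simp add: sum.distrib sum_distrib_left)
    also have "\<dots> \<le> (1 + \<epsilon>) * r + \<delta> * n"
      using a(2) \<open>0 < \<epsilon>\<close> by (intro add_right_mono mult_left_mono) auto
    finally have sum_H: "(\<Sum>i<n. H i) \<le> (1 + \<epsilon>) * r + \<delta> * n" .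
    let ?P = "Pi\<^sub>M {..<n} (\<lambda>_. \<mu>)"
    interpret P: product_prob_space "\<lambda>_. \<mu>" "{..<n}"
      by (intro product_prob_spaceI assms)
    have "2 * \<epsilon> * real n = 4 * (\<delta> * n)" "- (1 + \<epsilon>) * r = - ((1 + \<epsilon>) * r)" "0 \<le> \<delta> * n"
      using \<open>0 < \<epsilon>\<close> by (simp_all add: \<delta>_def algebra_simps)
    then have "- (1 + \<epsilon>) * r - 2 * \<epsilon> * real n \<le> (- (\<Sum>i<n. H i) - \<delta> * n) + - (\<delta> * n)"
      using sum_H by linarith
    then have "exp (- (1 + \<epsilon>) * r - 2 * \<epsilon> * real n) \<le> exp ((- (\<Sum>i<n. H i) - \<delta> * n) + - (\<delta> * n))"
      by (simp only: exp_le_cancel_iff)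
    also have "\<dots> = exp (- (\<Sum>i<n. H i) - \<delta> * n) * exp (- (\<delta> * n))"
      by (rule exp_add)
    also have "\<dots> \<le> exp (- (\<Sum>i<n. H i) - \<delta> * n) * (\<theta> - exp (- (\<delta>\<^sup>2 * n / (2 * B\<^sup>2))))"
      using n0[OF n(1)] by (intro mult_left_mono) auto
    also have "\<dots> \<le> measure ?P {z \<in> space ?P. (\<Sum>i<n. \<bar>\<xi> i\<bar> * \<bar>x i\<bar>) \<le> (\<Sum>i<n. \<bar>\<xi> i\<bar> * (s i * z i))}"
      using \<theta>B \<open>0 < \<delta>\<close> n H(2) by (intro halfspace_measure_ge[OF assms(1,2)]) auto
    also have "\<dots> \<le> measure ?P {z \<in> space ?P. b \<le> inner_n n \<xi> z}"
    proof (rule P.P.finite_measure_mono)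
      have "(\<Sum>i<n. \<bar>\<xi> i\<bar> * (s i * z i)) = inner_n n \<xi> z" for z
        unfolding inner_n_def by (intro sum.cong) (auto simp: s_def)
      moreover have "inner_n n \<xi> x \<le> (\<Sum>i<n. \<bar>\<xi> i\<bar> * \<bar>x i\<bar>)"
        unfolding inner_n_def by (intro sum_mono) (simp flip: abs_mult)
      ultimately show "{z \<in> space ?P. (\<Sum>i<n. \<bar>\<xi> i\<bar> * \<bar>x i\<bar>) \<le> (\<Sum>i<n. \<bar>\<xi> i\<bar> * (s i * z i))}
          \<subseteq> {z \<in> space ?P. b \<le> inner_n n \<xi> z}"
        using b by auto
      show "{z \<in> space ?P. b \<le> inner_n n \<xi> z} \<in> sets ?P"
        unfolding inner_n_def by measurable
    qed
    also have "\<dots> = y"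
      by (simp add: y mu_n_def space_PiM)
    finally show "exp (- (1 + \<epsilon>) * r - 2 * \<epsilon> * real n) \<le> y" .
  qed
  then show "\<exists>n0::nat. \<forall>n\<ge>n0. n \<ge> 1 \<longrightarrow> (\<forall>r>0. \<forall>x \<in> B_r n \<mu> r.
           tukey_depth n \<mu> x \<ge> exp (- (1 + \<epsilon>) * r - 2 * \<epsilon> * real n))"
    by blast
qed

end
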